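(* Let $(x,y)$ be such that, for all $i\in F$, $L(i,x)\le\mu T y_i$ for some constant $\mu\ge 1$, and all other constraints of $\operatorname{SC-LP}(T,k)$ on the variables $x$ are satisfied (namely $\sum_{i\in F}x_{ij}=1$ for all $j\in C$, $x_{ij}\le y_i$, $x_{ij}\in[0,1]$, $y_i\in[0,1]$, and $x_{ij}=0$ whenever $d(i,j)>T$). There exists a polynomial time algorithm that, given such a solution $(x,y)$ and a constant $\gamma\in(0,1)$, finds a solution $(x',y')$ such that (1) $y'=y$, and if $x_{ij}=0$ then $x'_{ij}=0$; (2) for every $(i,j)\in F\times C$, $y'_i\ge x'_{ij}$, and if $x'_{ij}>0$ then $x'_{ij}\ge\gamma y'_i$; (3) for every $j\in C$, $1\ge\sum_{i\in F}x'_{ij}\ge 1-\gamma$; (4) for every $i\in F$, $L(i,x')\le(\mu+2-\gamma)T y'_i$.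
   Context: Let $F$ (facilities) and $C$ (clients) be finite sets, $(F\cup C,d)$ a finite metric space, $T>0$, $k>0$. The polytope $\operatorname{SC-LP}(T,k)$ consists of $(x,y)$ with $\sum_{j\in C}d(i,j)x_{ij}\le Ty_i$ for all $i\in F$, $\sum_{i\in F}y_i\le k$, $\sum_{i\in F}x_{ij}=1$ for all $j\in C$, $x_{ij}\le y_i$, $y_i,x_{ij}\in[0,1]$, and $x_{ij}=0$ whenever $d(i,j)>T$. For an assignment $x$ and $i\in F$, $L(i,x):=\sum_{j\in C}d(i,j)x_{ij}$. *)

theory Defs
  imports
    "HOL-Analysis.Abstract_Metric_Spaces"
    "HOL-Computational_Algebra.Polynomial"
    "HOL-Library.Log_Nat"
begin

section \<open>The linear program and the rounding guarantee\<close>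

definition load :: "nat set \<Rightarrow> (nat \<Rightarrow> nat \<Rightarrow> real) \<Rightarrow> (nat \<Rightarrow> nat \<Rightarrow> real) \<Rightarrow> nat \<Rightarrow> real" where
  "load C d x i = (\<Sum>j\<in>C. d i j * x i j)"

text \<open>The constraints of SC-LP, with the load bound relaxed by the factor \<open>\<mu>\<close> and without the
  cardinality constraint \<open>(\<Sum>i\<in>F. y i) \<le> k\<close>.\<close>

definition relaxed_SC_LP ::
  "nat set \<Rightarrow> nat set \<Rightarrow> (nat \<Rightarrow> nat \<Rightarrow> real) \<Rightarrow> real \<Rightarrow> real
     \<Rightarrow> (nat \<Rightarrow> nat \<Rightarrow> real) \<Rightarrow> (nat \<Rightarrow> real) \<Rightarrow> bool" where
  "relaxed_SC_LP F C d T \<mu> x y \<longleftrightarrow>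
     (\<forall>i\<in>F. load C d x i \<le> \<mu> * T * y i) \<and>
     (\<forall>j\<in>C. (\<Sum>i\<in>F. x i j) = 1) \<and>
     (\<forall>i\<in>F. \<forall>j\<in>C. x i j \<le> y i) \<and>
     (\<forall>i\<in>F. \<forall>j\<in>C. 0 \<le> x i j \<and> x i j \<le> 1) \<and>
     (\<forall>i\<in>F. 0 \<le> y i \<and> y i \<le> 1) \<and>
     (\<forall>i\<in>F. \<forall>j\<in>C. d i j > T \<longrightarrow> x i j = 0)"

definition rounded_solution ::
  "nat set \<Rightarrow> nat set \<Rightarrow> (nat \<Rightarrow> nat \<Rightarrow> real) \<Rightarrow> real \<Rightarrow> real \<Rightarrow> real
     \<Rightarrow> (nat \<Rightarrow> nat \<Rightarrow> real) \<Rightarrow> (nat \<Rightarrow> real) \<Rightarrow> (nat \<Rightarrow> nat \<Rightarrow> real) \<Rightarrow> (nat \<Rightarrow> real) \<Rightarrow> bool" where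
  "rounded_solution F C d T \<mu> \<gamma> x y x' y' \<longleftrightarrow>
     (\<forall>i\<in>F. \<forall>j\<in>C. 0 \<le> x' i j) \<and>
     (\<forall>i\<in>F. y' i = y i) \<and>
     (\<forall>i\<in>F. \<forall>j\<in>C. x i j = 0 \<longrightarrow> x' i j = 0) \<and>
     (\<forall>i\<in>F. \<forall>j\<in>C. x' i j \<le> y' i \<and> (x' i j > 0 \<longrightarrow> \<gamma> * y' i \<le> x' i j)) \<and>
     (\<forall>j\<in>C. (\<Sum>i\<in>F. x' i j) \<le> 1 \<and> 1 - \<gamma> \<le> (\<Sum>i\<in>F. x' i j)) \<and>
     (\<forall>i\<in>F. load C d x' i \<le> (\<mu> + 2 - \<gamma>) * T * y' i)"

section \<open>Algorithms and their running time\<close>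

text \<open>
  Algorithms are structured programs for a random access machine with two kinds of memory cells:
  natural-number cells, used for addressing and control, and number cells, holding the data.
  Cells are grouped into finitely many named two-dimensional arrays per program; a scalar is the
  entry \<open>(0, 0)\<close> of an array. Addresses are always natural numbers, and there is no rounding
  operation and no conversion from number cells to natural-number cells.

  There are no multiplications of naturals, so with unit costs \<open>t\<close> steps produce addresses
  of \<open>O(t)\<close> bits only.
\<close>

datatype iexp =
    IConst nat
  | ICell string iexp iexp
  | IPlus iexp iexp
  | IMinus iexp iexp

datatype rexp =
    RConst int
  | RCell string iexp iexp
  | RPlus rexp rexp
  | RMinus rexp rexp
  | RTimes rexp rexp
  | RDivide rexp rexp

datatype bexp =
    ILess iexp iexp
  | RLess rexp rexp
  | BNot bexp
  | BAnd bexp bexp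

datatype com =
    CSkip
  | CSetI string iexp iexp iexp
  | CSetR string iexp iexp rexp
  | CSeq com com
  | CIf bexp com com
  | CWhile bexp com

record state =
  imem :: "string \<Rightarrow> nat \<Rightarrow> nat \<Rightarrow> nat"
  rmem :: "string \<Rightarrow> nat \<Rightarrow> nat \<Rightarrow> real"

fun ival :: "iexp \<Rightarrow> state \<Rightarrow> nat" where
  "ival (IConst n) s = n"
| "ival (ICell a e f) s = imem s a (ival e s) (ival f s)"
| "ival (IPlus e f) s = ival e s + ival f s"
| "ival (IMinus e f) s = ival e s - ival f s"

fun rval :: "rexp \<Rightarrow> state \<Rightarrow> real" where
  "rval (RConst k) s = of_int k"
| "rval (RCell a e f) s = rmem s a (ival e s) (ival f s)"
| "rval (RPlus e f) s = rval e s + rval f s"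
| "rval (RMinus e f) s = rval e s - rval f s"
| "rval (RTimes e f) s = rval e s * rval f s"
| "rval (RDivide e f) s = rval e s / rval f s"

fun bval :: "bexp \<Rightarrow> state \<Rightarrow> bool" where
  "bval (ILess e f) s \<longleftrightarrow> ival e s < ival f s"
| "bval (RLess e f) s \<longleftrightarrow> rval e s < rval f s"
| "bval (BNot b) s \<longleftrightarrow> \<not> bval b s"
| "bval (BAnd b c) s \<longleftrightarrow> bval b s \<and> bval c s"

text \<open>
  Costs are relative to size functions \<open>wi\<close> and \<open>wr\<close> for the two kinds of values: every
  evaluation of a subexpression, in particular every address computation, every operand and every
  result of an operation, is charged the size of its value.
\<close>

fun icost :: "(nat \<Rightarrow> nat) \<Rightarrow> iexp \<Rightarrow> state \<Rightarrow> nat" where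
  "icost wi (IConst n) s = wi n"
| "icost wi (ICell a e f) s = icost wi e s + icost wi f s + wi (ival (ICell a e f) s)"
| "icost wi (IPlus e f) s = icost wi e s + icost wi f s + wi (ival (IPlus e f) s)"
| "icost wi (IMinus e f) s = icost wi e s + icost wi f s + wi (ival (IMinus e f) s)"

fun rcost :: "(nat \<Rightarrow> nat) \<Rightarrow> (real \<Rightarrow> nat) \<Rightarrow> rexp \<Rightarrow> state \<Rightarrow> nat" where
  "rcost wi wr (RConst k) s = wr (of_int k)"
| "rcost wi wr (RCell a e f) s = icost wi e s + icost wi f s + wr (rval (RCell a e f) s)"
| "rcost wi wr (RPlus e f) s = rcost wi wr e s + rcost wi wr f s + wr (rval (RPlus e f) s)"
| "rcost wi wr (RMinus e f) s = rcost wi wr e s + rcost wi wr f s + wr (rval (RMinus e f) s)"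
| "rcost wi wr (RTimes e f) s = rcost wi wr e s + rcost wi wr f s + wr (rval (RTimes e f) s)"
| "rcost wi wr (RDivide e f) s = rcost wi wr e s + rcost wi wr f s + wr (rval (RDivide e f) s)"

fun bcost :: "(nat \<Rightarrow> nat) \<Rightarrow> (real \<Rightarrow> nat) \<Rightarrow> bexp \<Rightarrow> state \<Rightarrow> nat" where
  "bcost wi wr (ILess e f) s = icost wi e s + icost wi f s + 1"
| "bcost wi wr (RLess e f) s = rcost wi wr e s + rcost wi wr f s + 1"
| "bcost wi wr (BNot b) s = bcost wi wr b s + 1"
| "bcost wi wr (BAnd b c) s = bcost wi wr b s + bcost wi wr c s + 1"

definition set_icell :: "string \<Rightarrow> nat \<Rightarrow> nat \<Rightarrow> nat \<Rightarrow> state \<Rightarrow> state" where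
  "set_icell a i j v s = s\<lparr>imem := (imem s)(a := (imem s a)(i := (imem s a i)(j := v)))\<rparr>"

definition set_rcell :: "string \<Rightarrow> nat \<Rightarrow> nat \<Rightarrow> real \<Rightarrow> state \<Rightarrow> state" where
  "set_rcell a i j v s = s\<lparr>rmem := (rmem s)(a := (rmem s a)(i := (rmem s a i)(j := v)))\<rparr>"

text \<open>\<open>exec wi wr c s t s'\<close>: started in \<open>s\<close>, the program \<open>c\<close> halts in \<open>s'\<close> at total cost \<open>t\<close>.\<close>

inductive exec ::
  "(nat \<Rightarrow> nat) \<Rightarrow> (real \<Rightarrow> nat) \<Rightarrow> com \<Rightarrow> state \<Rightarrow> nat \<Rightarrow> state \<Rightarrow> bool"
  for wi :: "nat \<Rightarrow> nat" and wr :: "real \<Rightarrow> nat" where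
  Skip: "exec wi wr CSkip s 1 s"
| SetI: "exec wi wr (CSetI a e f g) s (1 + icost wi e s + icost wi f s + icost wi g s)
           (set_icell a (ival e s) (ival f s) (ival g s) s)"
| SetR: "exec wi wr (CSetR a e f g) s (1 + icost wi e s + icost wi f s + rcost wi wr g s)
           (set_rcell a (ival e s) (ival f s) (rval g s) s)"
| Seq: "exec wi wr c1 s1 t1 s2 \<Longrightarrow> exec wi wr c2 s2 t2 s3 \<Longrightarrow>
          exec wi wr (CSeq c1 c2) s1 (1 + t1 + t2) s3"
| IfTrue: "bval b s \<Longrightarrow> exec wi wr c1 s t s' \<Longrightarrow>
          exec wi wr (CIf b c1 c2) s (1 + bcost wi wr b s + t) s'"
| IfFalse: "\<not> bval b s \<Longrightarrow> exec wi wr c2 s t s' \<Longrightarrow>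
          exec wi wr (CIf b c1 c2) s (1 + bcost wi wr b s + t) s'"
| WhileFalse: "\<not> bval b s \<Longrightarrow> exec wi wr (CWhile b c) s (1 + bcost wi wr b s) s"
| WhileTrue: "bval b s1 \<Longrightarrow> exec wi wr c s1 t1 s2 \<Longrightarrow> exec wi wr (CWhile b c) s2 t2 s3 \<Longrightarrow>
          exec wi wr (CWhile b c) s1 (1 + bcost wi wr b s1 + t1 + t2) s3"

text \<open>
  Two cost measures are used. The unit costs count the steps and the arithmetic operations, for
  arbitrary real data. The bit costs charge the binary length of all values, for rational data;
  polynomially bounded bit cost is equivalent to polynomial running time on a Turing machine.
\<close>

definition unit_isize :: "nat \<Rightarrow> nat" where
  "unit_isize n = 1"

definition unit_rsize :: "real \<Rightarrow> nat" where
  "unit_rsize r = 1"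

definition bit_isize :: "nat \<Rightarrow> nat" where
  "bit_isize n = 1 + floorlog 2 n"

definition rat_size :: "rat \<Rightarrow> nat" where
  "rat_size q = (case quotient_of q of (a, b) \<Rightarrow> bit_isize (nat \<bar>a\<bar>) + bit_isize (nat b))"

text \<open>Meaningful for rational arguments only.\<close>

definition bit_rsize :: "real \<Rightarrow> nat" where
  "bit_rsize r = rat_size (THE q. of_rat q = r)"

section \<open>Input and output\<close>

text \<open>
  The points of the metric space are numbered \<open>0, \<dots>, n - 1\<close>. The subsets \<open>F\<close> and \<open>C\<close>, which may
  overlap, are given by their indicator vectors. The input does not contain \<open>\<mu>\<close>.
\<close>

definition input_state ::
  "nat \<Rightarrow> nat set \<Rightarrow> nat set \<Rightarrow> (nat \<Rightarrow> nat \<Rightarrow> real) \<Rightarrow> real \<Rightarrow> real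
     \<Rightarrow> (nat \<Rightarrow> nat \<Rightarrow> real) \<Rightarrow> (nat \<Rightarrow> real) \<Rightarrow> state" where
  "input_state n F C d T \<gamma> x y =
     \<lparr>imem = (\<lambda>a i j.
        if a = ''n'' \<and> i = 0 \<and> j = 0 then n
        else if a = ''F'' \<and> i \<in> F \<and> j = 0 then 1
        else if a = ''C'' \<and> i \<in> C \<and> j = 0 then 1
        else 0),
      rmem = (\<lambda>a i j.
        if a = ''T'' \<and> i = 0 \<and> j = 0 then T
        else if a = ''gamma'' \<and> i = 0 \<and> j = 0 then \<gamma>
        else if a = ''d'' \<and> i < n \<and> j < n then d i j
        else if a = ''x'' \<and> i \<in> F \<and> j \<in> C then x i j
        else if a = ''y'' \<and> i \<in> F \<and> j = 0 then y i
        else 0)\<rparr>"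

definition rational_input ::
  "nat \<Rightarrow> nat set \<Rightarrow> nat set \<Rightarrow> (nat \<Rightarrow> nat \<Rightarrow> real) \<Rightarrow> real \<Rightarrow> real
     \<Rightarrow> (nat \<Rightarrow> nat \<Rightarrow> real) \<Rightarrow> (nat \<Rightarrow> real) \<Rightarrow> bool" where
  "rational_input n F C d T \<gamma> x y \<longleftrightarrow>
     T \<in> \<rat> \<and> \<gamma> \<in> \<rat> \<and> (\<forall>i<n. \<forall>j<n. d i j \<in> \<rat>) \<and>
     (\<forall>i\<in>F. \<forall>j\<in>C. x i j \<in> \<rat>) \<and> (\<forall>i\<in>F. y i \<in> \<rat>)"

definition input_size ::
  "(nat \<Rightarrow> nat) \<Rightarrow> (real \<Rightarrow> nat) \<Rightarrow> nat \<Rightarrow> nat set \<Rightarrow> nat set \<Rightarrow> (nat \<Rightarrow> nat \<Rightarrow> real) \<Rightarrow> real \<Rightarrow> real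
     \<Rightarrow> (nat \<Rightarrow> nat \<Rightarrow> real) \<Rightarrow> (nat \<Rightarrow> real) \<Rightarrow> nat" where
  "input_size wi wr n F C d T \<gamma> x y =
     wi n + (\<Sum>i<n. wi (of_bool (i \<in> F)) + wi (of_bool (i \<in> C))) +
     wr T + wr \<gamma> + (\<Sum>i<n. \<Sum>j<n. wr (d i j)) +
     (\<Sum>i\<in>F. \<Sum>j\<in>C. wr (x i j)) + (\<Sum>i\<in>F. wr (y i))"

definition output_x :: "state \<Rightarrow> nat \<Rightarrow> nat \<Rightarrow> real" where
  "output_x s i j = rmem s ''xout'' i j"

definition output_y :: "state \<Rightarrow> nat \<Rightarrow> real" where
  "output_y s i = rmem s ''yout'' i 0"

end

theory Submission
  imports Defs
begin

text \<open>
  A value \<open>x i j\<close> with \<open>0 < x i j < \<gamma> y i\<close> is written as \<open>\<gamma> y i w i j\<close> with \<open>0 < w i j < 1\<close>, and it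
  suffices to round the weights \<open>w\<close> to zero or one. As in the rounding of Shmoys and Tardos, every
  facility distributes its weights to unit slots in decreasing order of the distances, so that at
  most one selected client per slot increases the load by at most \<open>\<gamma> T y i\<close>. Every client in the
  same way distributes its weights to unit slots in decreasing order of the \<open>y i\<close>; if every full slot
  selects a facility, the client loses at most \<open>\<gamma>\<close>. Both kinds of slots are coordinated by a
  bipartite matching whose left side is saturated by the fractional solution. An integral matching
  is found by an auction: an unmatched left node takes a neighbour of smallest label, evicts its
  owner and raises the label. Small selected values are finally dropped when the total of a client
  would exceed one.

  The only numbers that are computed are sums of at most \<open>2 n + 2\<close> terms \<open>1\<close>, \<open>x i j\<close>, \<open>\<gamma> y i\<close> and
  \<open>w i j\<close>, hence the bit costs are polynomial as well.
\<close>

section \<open>A weakest-precondition calculus with costs\<close>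

text \<open>The obstacle is that the two kinds of slots pull in opposite directions: a facility slot
  may select at most one pair, a full client slot must select at least one. Splitting every pair
  into a left and a right copy removes the conflict: the left copy must be placed, on its own right
  copy or on a facility slot, and a client slot can only take a right copy that was vacated. All
  lower bounds become saturation of the left side, all upper bounds capacities of the right side.
  The overlaps of items with slots, with \<open>1 - w i j\<close> on the edge between the two
  copies, are a fractional solution of this instance. It is never computed; it only certifies that
  an unmatched node sees a small label. The auction itself needs nothing but comparisons and
  increments of naturals, and the program consists of counting loops, so its cost can be read off
  its syntax. Correctness is proved for abstract size functions, of which the unit and the bit
  measure are two instances.\<close>

fun isz :: "iexp \<Rightarrow> nat" where
  "isz (IConst n) = 1"
| "isz (ICell a e f) = isz e + isz f + 1"
| "isz (IPlus e f) = isz e + isz f + 1"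
| "isz (IMinus e f) = isz e + isz f + 1"

fun rsz :: "rexp \<Rightarrow> nat" where
  "rsz (RConst k) = 1"
| "rsz (RCell a e f) = isz e + isz f + 1"
| "rsz (RPlus e f) = rsz e + rsz f + 1"
| "rsz (RMinus e f) = rsz e + rsz f + 1"
| "rsz (RTimes e f) = rsz e + rsz f + 1"
| "rsz (RDivide e f) = rsz e + rsz f + 1"

fun bsz :: "bexp \<Rightarrow> nat" where
  "bsz (ILess e f) = isz e + isz f + 1"
| "bsz (RLess e f) = rsz e + rsz f + 1"
| "bsz (BNot b) = bsz b + 1"
| "bsz (BAnd b c) = bsz b + bsz c + 1"

text \<open>Bounds the cost when every value costs at most \<open>B\<close> and every loop makes at most \<open>M\<close>
  iterations.\<close>

fun ctime :: "nat \<Rightarrow> nat \<Rightarrow> com \<Rightarrow> nat" where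
  "ctime B M CSkip = 1"
| "ctime B M (CSetI a e f g) = 1 + (isz e + isz f + isz g) * B"
| "ctime B M (CSetR a e f g) = 1 + (isz e + isz f + rsz g) * B"
| "ctime B M (CSeq c c') = 1 + ctime B M c + ctime B M c'"
| "ctime B M (CIf b c c') = 1 + bsz b * B + (ctime B M c + ctime B M c')"
| "ctime B M (CWhile b c) = 1 + bsz b * B + M * (1 + bsz b * B + ctime B M c)"

text \<open>For a fixed program \<open>ctime\<close> is polynomial in its two bounds; substituting
  polynomials in the input size for them gives the polynomial of the theorem.\<close>

fun ctime_poly :: "nat poly \<Rightarrow> nat poly \<Rightarrow> com \<Rightarrow> nat poly" where
  "ctime_poly B M CSkip = 1"
| "ctime_poly B M (CSetI a e f g) = 1 + smult (isz e + isz f + isz g) B"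
| "ctime_poly B M (CSetR a e f g) = 1 + smult (isz e + isz f + rsz g) B"
| "ctime_poly B M (CSeq c c') = 1 + ctime_poly B M c + ctime_poly B M c'"
| "ctime_poly B M (CIf b c c') = 1 + smult (bsz b) B + (ctime_poly B M c + ctime_poly B M c')"
| "ctime_poly B M (CWhile b c) =
     1 + smult (bsz b) B + M * (1 + smult (bsz b) B + ctime_poly B M c)"

lemma poly_ctime_poly: "poly (ctime_poly B M c) z = ctime (poly B z) (poly M z) c"
  by (induction c) auto

inductive_cases exec_elims:
  "exec wi wr CSkip s t s'"
  "exec wi wr (CSetI a e f g) s t s'"
  "exec wi wr (CSetR a e f g) s t s'"
  "exec wi wr (CSeq c c') s t s'"
  "exec wi wr (CIf b c c') s t s'"
  "exec wi wr (CWhile b c) s t s'"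

text \<open>The two cost measures yield two separate runs. Costs never influence the state, so both
  runs end in the same one.\<close>

lemma exec_deterministic:
  assumes "exec wi wr c s t s1" "exec wi' wr' c s t' s2"
  shows "s1 = s2"
  using assms
proof (induction arbitrary: t' s2 rule: exec.induct)
  case Skip
  then show ?case by (auto elim: exec_elims)
next
  case (SetI a e f g s)
  then show ?case by (auto elim: exec_elims)
next
  case (SetR a e f g s)
  then show ?case by (auto elim: exec_elims)
next
  case (Seq c1 s1 t1 s2 c2 t2 s3)
  then show ?case by (blast elim: exec_elims)
next
  case (IfTrue b s c1 t s' c2)
  then show ?case by (blast elim: exec_elims)
next
  case (IfFalse b s c2 t s' c1)
  then show ?case by (blast elim: exec_elims)
next
  case (WhileFalse b s c)
  then show ?case by (blast elim: exec_elims)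
next
  case (WhileTrue b s1 c t1 s2 t2 s3)
  from WhileTrue.prems show ?case
    by (rule exec_elims(6)) (use WhileTrue in blast)+
qed

lemma imem_set_icell [simp]:
  "imem (set_icell a i j v s) =
     (imem s)(a := (imem s a)(i := (imem s a i)(j := v)))"
  and rmem_set_icell [simp]: "rmem (set_icell a i j v s) = rmem s"
  by (auto simp: set_icell_def)

lemma rmem_set_rcell [simp]:
  "rmem (set_rcell a i j v s) =
     (rmem s)(a := (rmem s a)(i := (rmem s a i)(j := v)))"
  and imem_set_rcell [simp]: "imem (set_rcell a i j v s) = imem s"
  by (auto simp: set_rcell_def)

abbreviation ivar :: "string \<Rightarrow> iexp" where
  "ivar a \<equiv> ICell a (IConst 0) (IConst 0)"

abbreviation rvar :: "string \<Rightarrow> rexp" where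
  "rvar a \<equiv> RCell a (IConst 0) (IConst 0)"

abbreviation set_ivar :: "string \<Rightarrow> iexp \<Rightarrow> com" where
  "set_ivar a e \<equiv> CSetI a (IConst 0) (IConst 0) e"

abbreviation set_rvar :: "string \<Rightarrow> rexp \<Rightarrow> com" where
  "set_rvar a e \<equiv> CSetR a (IConst 0) (IConst 0) e"

definition CFor :: "string \<Rightarrow> string \<Rightarrow> com \<Rightarrow> com" where
  "CFor a b c = CSeq (set_ivar a (IConst 0))
     (CWhile (ILess (ivar a) (ivar b)) (CSeq c (set_ivar a (IPlus (ivar a) (IConst 1)))))"

abbreviation BOr :: "bexp \<Rightarrow> bexp \<Rightarrow> bexp" where
  "BOr b c \<equiv> BNot (BAnd (BNot b) (BNot c))"

fun CSeqs :: "com list \<Rightarrow> com" where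
  "CSeqs [] = CSkip"
| "CSeqs [c] = c"
| "CSeqs (c # c' # cs) = CSeq c (CSeqs (c' # cs))"

text \<open>Naturals are controlled by the bound \<open>K\<close>, data by membership in
  \<open>R\<close>. A set is used for the data because the admissible numbers are described by how
  they arise as sums, not by their magnitude; for unit costs it is the set of all reals.\<close>

locale cost_model =
  fixes wi :: "nat \<Rightarrow> nat" and wr :: "real \<Rightarrow> nat" and B M K :: nat and R :: "real set"
  assumes wi_le: "k \<le> K \<Longrightarrow> wi k \<le> B"
    and wr_le: "r \<in> R \<Longrightarrow> wr r \<le> B"
    and B_pos: "1 \<le> B"
    and zero_one_in_R: "0 \<in> R" "1 \<in> R"
begin

definition bounded_state :: "state \<Rightarrow> bool" where
  "bounded_state s \<longleftrightarrow> (\<forall>a i j. imem s a i j \<le> K \<and> rmem s a i j \<in> R)"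

text \<open>Truncated subtraction never exceeds its first operand, so among the operations on
  naturals only addition needs a range check.\<close>

fun iok :: "iexp \<Rightarrow> state \<Rightarrow> bool" where
  "iok (IConst n) s \<longleftrightarrow> n \<le> K"
| "iok (ICell a e f) s \<longleftrightarrow> iok e s \<and> iok f s"
| "iok (IPlus e f) s \<longleftrightarrow> iok e s \<and> iok f s \<and> ival e s + ival f s \<le> K"
| "iok (IMinus e f) s \<longleftrightarrow> iok e s \<and> iok f s"

fun rok :: "rexp \<Rightarrow> state \<Rightarrow> bool" where
  "rok (RConst k) s \<longleftrightarrow> real_of_int k \<in> R"
| "rok (RCell a e f) s \<longleftrightarrow> iok e s \<and> iok f s"
| "rok (RPlus e f) s \<longleftrightarrow> rok e s \<and> rok f s \<and> rval e s + rval f s \<in> R"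
| "rok (RMinus e f) s \<longleftrightarrow> rok e s \<and> rok f s \<and> rval e s - rval f s \<in> R"
| "rok (RTimes e f) s \<longleftrightarrow> rok e s \<and> rok f s \<and> rval e s * rval f s \<in> R"
| "rok (RDivide e f) s \<longleftrightarrow> rok e s \<and> rok f s \<and> rval e s / rval f s \<in> R"

fun bok :: "bexp \<Rightarrow> state \<Rightarrow> bool" where
  "bok (ILess e f) s \<longleftrightarrow> iok e s \<and> iok f s"
| "bok (RLess e f) s \<longleftrightarrow> rok e s \<and> rok f s"
| "bok (BNot b) s \<longleftrightarrow> bok b s"
| "bok (BAnd b c) s \<longleftrightarrow> bok b s \<and> bok c s"

lemma ival_le: "bounded_state s \<Longrightarrow> iok e s \<Longrightarrow> ival e s \<le> K"
proof (induction e)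
  case (IMinus e f)
  then have "ival e s \<le> K" by simp
  then show ?case by simp
qed (auto simp: bounded_state_def)

lemma rval_in: "bounded_state s \<Longrightarrow> rok e s \<Longrightarrow> rval e s \<in> R"
  by (induction e) (auto simp: bounded_state_def)

lemma icost_le: "bounded_state s \<Longrightarrow> iok e s \<Longrightarrow> icost wi e s \<le> isz e * B"
proof (induction e)
  case (ICell a e f)
  then have "wi (ival (ICell a e f) s) \<le> B" by (intro wi_le ival_le) auto
  with ICell show ?case by (simp add: algebra_simps)
next
  case (IPlus e f)
  then have "wi (ival (IPlus e f) s) \<le> B" by (intro wi_le ival_le) auto
  with IPlus show ?case by (simp add: algebra_simps)
next
  case (IMinus e f)
  then have "wi (ival (IMinus e f) s) \<le> B" by (intro wi_le ival_le) auto
  with IMinus show ?case by (simp add: algebra_simps)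
qed (auto intro: wi_le)

lemma rcost_le: "bounded_state s \<Longrightarrow> rok e s \<Longrightarrow> rcost wi wr e s \<le> rsz e * B"
proof (induction e)
  case (RCell a e f)
  then have "wr (rval (RCell a e f) s) \<le> B" by (intro wr_le rval_in) auto
  with RCell icost_le[of s e] icost_le[of s f] show ?case by (simp add: algebra_simps)
next
  case (RPlus e f)
  then have "wr (rval (RPlus e f) s) \<le> B" by (intro wr_le rval_in) auto
  with RPlus show ?case by (simp add: algebra_simps)
next
  case (RMinus e f)
  then have "wr (rval (RMinus e f) s) \<le> B" by (intro wr_le rval_in) auto
  with RMinus show ?case by (simp add: algebra_simps)
next
  case (RTimes e f)
  then have "wr (rval (RTimes e f) s) \<le> B" by (intro wr_le rval_in) auto
  with RTimes show ?case by (simp add: algebra_simps)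
next
  case (RDivide e f)
  then have "wr (rval (RDivide e f) s) \<le> B" by (intro wr_le rval_in) auto
  with RDivide show ?case by (simp add: algebra_simps)
qed (auto intro: wr_le)

lemma bcost_le: "bounded_state s \<Longrightarrow> bok b s \<Longrightarrow> bcost wi wr b s \<le> bsz b * B"
proof (induction b)
  case (ILess e f)
  then show ?case using icost_le[of s e] icost_le[of s f] B_pos by (simp add: algebra_simps)
next
  case (RLess e f)
  then show ?case using rcost_le[of s e] rcost_le[of s f] B_pos by (simp add: algebra_simps)
qed (use B_pos in \<open>auto simp: algebra_simps\<close>)

text \<open>Total correctness with the cost bound and the boundedness of the memory built in. Both
  are discharged once per construct, so later goals speak only of the functional behaviour and of
  the range checks.\<close>

definition wp :: "com \<Rightarrow> (state \<Rightarrow> bool) \<Rightarrow> state \<Rightarrow> bool" where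
  "wp c Q s \<longleftrightarrow> (bounded_state s \<longrightarrow>
     (\<exists>t s'. exec wi wr c s t s' \<and> t \<le> ctime B M c \<and> bounded_state s' \<and> Q s'))"

lemma wp_mono: "wp c Q s \<Longrightarrow> (\<And>s'. bounded_state s' \<Longrightarrow> Q s' \<Longrightarrow> Q' s') \<Longrightarrow> wp c Q' s"
  unfolding wp_def by blast

lemma wp_CSkip: "Q s \<Longrightarrow> wp CSkip Q s"
  unfolding wp_def by (force intro: exec.Skip)

lemma wp_CSetI:
  assumes "iok e s" "iok f s" "iok g s" "Q (set_icell a (ival e s) (ival f s) (ival g s) s)"
  shows "wp (CSetI a e f g) Q s"
  unfolding wp_def
proof (intro impI exI conjI)
  assume b: "bounded_state s"
  show "exec wi wr (CSetI a e f g) s (1 + icost wi e s + icost wi f s + icost wi g s)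
      (set_icell a (ival e s) (ival f s) (ival g s) s)"
    by (rule exec.SetI)
  show "1 + icost wi e s + icost wi f s + icost wi g s \<le> ctime B M (CSetI a e f g)"
    using icost_le[OF b assms(1)] icost_le[OF b assms(2)] icost_le[OF b assms(3)]
    by (simp add: algebra_simps)
  show "bounded_state (set_icell a (ival e s) (ival f s) (ival g s) s)"
    using b ival_le[OF b assms(3)] by (auto simp: bounded_state_def)
qed (use assms in auto)

lemma wp_CSetR:
  assumes "iok e s" "iok f s" "rok g s" "Q (set_rcell a (ival e s) (ival f s) (rval g s) s)"
  shows "wp (CSetR a e f g) Q s"
  unfolding wp_def
proof (intro impI exI conjI)
  assume b: "bounded_state s"
  show "exec wi wr (CSetR a e f g) s (1 + icost wi e s + icost wi f s + rcost wi wr g s)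
      (set_rcell a (ival e s) (ival f s) (rval g s) s)"
    by (rule exec.SetR)
  show "1 + icost wi e s + icost wi f s + rcost wi wr g s \<le> ctime B M (CSetR a e f g)"
    using icost_le[OF b assms(1)] icost_le[OF b assms(2)] rcost_le[OF b assms(3)]
    by (simp add: algebra_simps)
  show "bounded_state (set_rcell a (ival e s) (ival f s) (rval g s) s)"
    using b rval_in[OF b assms(3)] by (auto simp: bounded_state_def)
qed (use assms in auto)

lemma wp_CSeq:
  assumes "wp c (\<lambda>s'. wp c' Q s') s"
  shows "wp (CSeq c c') Q s"
  unfolding wp_def
proof
  assume "bounded_state s"
  with assms obtain t s' where 1: "exec wi wr c s t s'" "t \<le> ctime B M c" "bounded_state s'" "wp c' Q s'"
    unfolding wp_def[of c] by blast
  then obtain t' s'' where "exec wi wr c' s' t' s''" "t' \<le> ctime B M c'" "bounded_state s''" "Q s''"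
    unfolding wp_def by blast
  with 1 show "\<exists>t s'. exec wi wr (CSeq c c') s t s' \<and> t \<le> ctime B M (CSeq c c') \<and> bounded_state s' \<and> Q s'"
    using exec.Seq[OF 1(1)] by fastforce
qed

lemma wp_CIf:
  assumes b: "bok b s" and "bval b s \<Longrightarrow> wp c Q s" "\<not> bval b s \<Longrightarrow> wp c' Q s"
  shows "wp (CIf b c c') Q s"
  unfolding wp_def
proof
  assume s: "bounded_state s"
  show "\<exists>t s'. exec wi wr (CIf b c c') s t s' \<and> t \<le> ctime B M (CIf b c c') \<and> bounded_state s' \<and> Q s'"
  proof (cases "bval b s")
    case True
    with assms s obtain t s' where "exec wi wr c s t s'" "t \<le> ctime B M c" "bounded_state s'" "Q s'"
      unfolding wp_def by blast
    moreover from this have "exec wi wr (CIf b c c') s (1 + bcost wi wr b s + t) s'"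
      using True by (intro exec.IfTrue)
    ultimately show ?thesis using bcost_le[OF s b] by fastforce
  next
    case False
    with assms s obtain t s' where "exec wi wr c' s t s'" "t \<le> ctime B M c'" "bounded_state s'" "Q s'"
      unfolding wp_def by blast
    moreover from this have "exec wi wr (CIf b c c') s (1 + bcost wi wr b s + t) s'"
      using False by (intro exec.IfFalse)
    ultimately show ?thesis using bcost_le[OF s b] by fastforce
  qed
qed

text \<open>Since the body has to preserve counter and limit, there are exactly \<open>m\<close>
  rounds. The invariant for \<open>Suc k\<close> is demanded of the state with the counter already
  advanced, so it may mention the counter.\<close>

lemma wp_CFor:
  assumes m: "m \<le> M" "m \<le> K" "1 \<le> K"
    and ab: "a \<noteq> b"
    and init: "imem s b 0 0 = m" "I 0 (set_icell a 0 0 0 s)"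
    and body: "\<And>k s. k < m \<Longrightarrow> I k s \<Longrightarrow> imem s a 0 0 = k \<Longrightarrow> imem s b 0 0 = m \<Longrightarrow>
      wp c (\<lambda>s'. imem s' a 0 0 = k \<and> imem s' b 0 0 = m \<and> I (Suc k) (set_icell a 0 0 (Suc k) s')) s"
    and final: "\<And>s. I m s \<Longrightarrow> imem s a 0 0 = m \<Longrightarrow> imem s b 0 0 = m \<Longrightarrow> Q s"
  shows "wp (CFor a b c) Q s"
proof -
  let ?b = "ILess (ivar a) (ivar b)"
  let ?c = "CSeq c (set_ivar a (IPlus (ivar a) (IConst 1)))"
  let ?step = "1 + bsz ?b * B + ctime B M ?c"
  have bok: "bok ?b s" for s by simp
  \<comment> \<open>The remaining rounds are charged exactly; \<open>m - k\<close> is weakened to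
    the uniform \<open>M\<close> only after the induction.\<close>
  have loop: "\<exists>t s'. exec wi wr (CWhile ?b ?c) s t s' \<and>
      t \<le> 1 + bsz ?b * B + (m - k) * ?step \<and> bounded_state s' \<and> Q s'"
    if "bounded_state s" "I k s" "imem s a 0 0 = k" "imem s b 0 0 = m" "k \<le> m" for k s
    using that
  proof (induction "m - k" arbitrary: k s)
    case 0
    then have "\<not> bval ?b s" by simp
    then have "exec wi wr (CWhile ?b ?c) s (1 + bcost wi wr ?b s) s"
      by (rule exec.WhileFalse)
    moreover have "k = m" using 0 by simp
    moreover have "bcost wi wr ?b s \<le> bsz ?b * B"
      using 0(2) bok by (rule bcost_le)
    ultimately show ?case using 0 final by (intro exI conjI) auto
  next
    case (Suc l)
    then have k: "k < m" by simp
    have "wp ?c (\<lambda>s'. imem s' a 0 0 = Suc k \<and> imem s' b 0 0 = m \<and> I (Suc k) s') s"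
      by (intro wp_CSeq wp_mono[OF body[OF k Suc.prems(2,3,4)]] wp_CSetI) (use m k ab in auto)
    then obtain t1 s1 where 1: "exec wi wr ?c s t1 s1" "t1 \<le> ctime B M ?c" "bounded_state s1"
      "imem s1 a 0 0 = Suc k" "imem s1 b 0 0 = m" "I (Suc k) s1"
      using Suc.prems(1) unfolding wp_def by blast
    obtain t2 s2 where 2: "exec wi wr (CWhile ?b ?c) s1 t2 s2"
      "t2 \<le> 1 + bsz ?b * B + (m - Suc k) * ?step" "bounded_state s2" "Q s2"
      using Suc.hyps(1)[OF _ 1(3,6,4,5)] Suc.hyps(2) k by force
    have "bval ?b s" using k Suc.prems by simp
    then have ex: "exec wi wr (CWhile ?b ?c) s (1 + bcost wi wr ?b s + t1 + t2) s2"
      using 1 2 by (intro exec.WhileTrue)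
    have "bcost wi wr ?b s \<le> bsz ?b * B"
      using Suc.prems(1) bok by (rule bcost_le)
    then have "1 + bcost wi wr ?b s + t1 + t2 \<le> ?step + (1 + bsz ?b * B + (m - Suc k) * ?step)"
      using 1 2 by linarith
    also have "\<dots> = 1 + bsz ?b * B + (m - k) * ?step"
    proof -
      have "m - k = Suc (m - Suc k)" using k by simp
      then show ?thesis by simp
    qed
    finally show ?case using 2 ex by blast
  qed
  have "wp (CWhile ?b ?c) Q (set_icell a 0 0 0 s)"
    unfolding wp_def
  proof
    assume "bounded_state (set_icell a 0 0 0 s)"
    from loop[OF this, of 0] init ab obtain t s' where
      "exec wi wr (CWhile ?b ?c) (set_icell a 0 0 0 s) t s'"
      "t \<le> 1 + bsz ?b * B + m * ?step" "bounded_state s'" "Q s'" by auto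
    moreover have "m * ?step \<le> M * ?step" using m by (intro mult_right_mono) auto
    ultimately show "\<exists>t s'. exec wi wr (CWhile ?b ?c) (set_icell a 0 0 0 s) t s' \<and>
        t \<le> ctime B M (CWhile ?b ?c) \<and> bounded_state s' \<and> Q s'"
      unfolding ctime.simps by (meson add_left_mono order_trans)
  qed
  then show ?thesis
    unfolding CFor_def by (intro wp_CSeq wp_CSetI) auto
qed

end

section \<open>Bipartite matching by auction\<close>

text \<open>An owner \<open>0\<close> means that the right node is unowned, an owner \<open>Suc u\<close> that it is owned by \<open>u\<close>.\<close>

definition auction_inv ::
  "(nat \<times> nat) set \<Rightarrow> nat \<Rightarrow> nat set \<Rightarrow> (nat \<Rightarrow> nat) \<Rightarrow> (nat \<Rightarrow> nat) \<Rightarrow> bool" where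
  "auction_inv E N U own lab \<longleftrightarrow>
     U \<subseteq> Domain E \<and>
     (\<forall>v u. own v = Suc u \<longrightarrow> u \<notin> U \<and> (u, v) \<in> E \<and> (\<forall>v'. (u, v') \<in> E \<longrightarrow> lab v \<le> Suc (lab v'))) \<and>
     (\<forall>v v' u. own v = Suc u \<longrightarrow> own v' = Suc u \<longrightarrow> v = v') \<and>
     (\<forall>u\<in>Domain E - U. \<exists>v. own v = Suc u) \<and>
     (\<forall>v. own v = 0 \<longrightarrow> lab v = 0) \<and> (\<forall>v. lab v \<le> N)"

lemma auction_inv_free: "auction_inv E N U own lab \<Longrightarrow> U \<subseteq> Domain E"
  unfolding auction_inv_def by (elim conjE)

lemma auction_inv_lab: "auction_inv E N U own lab \<Longrightarrow> lab v \<le> N"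
  unfolding auction_inv_def by (elim conjE) (erule spec)

lemma auction_inv_unowned: "auction_inv E N U own lab \<Longrightarrow> own v = 0 \<Longrightarrow> lab v = 0"
  unfolding auction_inv_def by (elim conjE) (drule spec, erule mp)

text \<open>One bid. The slack of one in the invariant pays for the raise: \<open>v\<close> was
  cheapest for \<open>u\<close>, so after the raise it is at most one above the alternatives, while
  for every other owner the labels of the alternatives can only grow. This is approximate
  complementary slackness with increment one.\<close>

lemma auction_inv_step:
  assumes inv: "auction_inv E N U own lab" and u: "u \<in> U" and v: "(u, v) \<in> E"
    and min: "\<And>v'. (u, v') \<in> E \<Longrightarrow> lab v \<le> lab v'" and N: "lab v < N"
    and U': "\<And>u'. u' \<in> U' \<longleftrightarrow> (u' \<in> U \<or> own v = Suc u') \<and> u' \<noteq> u"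
  shows "auction_inv E N U' (own(v := Suc u)) (lab(v := Suc (lab v)))"
proof -
  have own: "own v1 = Suc u1 \<Longrightarrow> u1 \<notin> U" "own v1 = Suc u1 \<Longrightarrow> (u1, v1) \<in> E"
    "own v1 = Suc u1 \<Longrightarrow> (u1, v') \<in> E \<Longrightarrow> lab v1 \<le> Suc (lab v')"
    "own v1 = Suc u1 \<Longrightarrow> own v2 = Suc u1 \<Longrightarrow> v1 = v2" for v1 v2 u1 v'
    using inv unfolding auction_inv_def by blast+
  have matched: "\<exists>v. own v = Suc u1" if "u1 \<in> Domain E" "u1 \<notin> U" for u1
    using inv that unfolding auction_inv_def by blast
  have "U \<subseteq> Domain E" using inv by (rule auction_inv_free)
  note lab = auction_inv_unowned[OF inv] auction_inv_lab[OF inv]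
  show ?thesis
    unfolding auction_inv_def
  proof (intro conjI allI impI ballI)
    show "U' \<subseteq> Domain E"
      using \<open>U \<subseteq> Domain E\<close> own(2) U' by blast
  next
    fix v1 u1 assume 1: "(own(v := Suc u)) v1 = Suc u1"
    show "u1 \<notin> U'"
    proof (cases "v1 = v")
      case False
      then show ?thesis using 1 own U' by fastforce
    qed (use 1 U' in simp)
    show "(u1, v1) \<in> E"
      using 1 own(2) v by (cases "v1 = v") auto
    fix v' assume "(u1, v') \<in> E"
    then show "(lab(v := Suc (lab v))) v1 \<le> Suc ((lab(v := Suc (lab v))) v')"
      using 1 own(3)[of v1 u1 v'] v min[of v'] by (cases "v1 = v"; cases "v' = v") auto
  next
    fix v1 v2 u1 assume "(own(v := Suc u)) v1 = Suc u1" "(own(v := Suc u)) v2 = Suc u1"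
    then show "v1 = v2" using own(1)[of v1] own(1)[of v2] own(4)[of v1 u1 v2] u
      by (cases "v1 = v"; cases "v2 = v") auto
  next
    fix u1 assume u1: "u1 \<in> Domain E - U'"
    show "\<exists>v1. (own(v := Suc u)) v1 = Suc u1"
    proof (cases "u1 = u")
      case False
      then have "u1 \<notin> U" "own v \<noteq> Suc u1" using u1 U' by blast+
      then obtain v1 where "own v1 = Suc u1" "v1 \<noteq> v" using matched u1 by blast
      then show ?thesis by (intro exI[of _ v1]) simp
    qed auto
  next
    fix v1 assume "(own(v := Suc u)) v1 = 0"
    then show "(lab(v := Suc (lab v))) v1 = 0"
      using lab(1) by (simp split: if_splits)
  next
    fix v1 show "(lab(v := Suc (lab v))) v1 \<le> N"
      using lab(2) N by simp
  qed
qed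

text \<open>Summing \<open>lab (M u) \<le> 1 + lab v\<close> against a fractional matching that saturates the left side
  bounds the smallest label seen by an unmatched node by the number of matched nodes.\<close>

lemma auction_has_cheap_neighbour:
  fixes f :: "nat \<Rightarrow> nat \<Rightarrow> real"
  assumes inv: "auction_inv E N U own lab" and E: "E \<subseteq> {..<N} \<times> {..<N}" and u: "u \<in> U"
    and f_nonneg: "\<And>u v. 0 \<le> f u v" and f_supp: "\<And>u v. (u, v) \<notin> E \<Longrightarrow> f u v = 0"
    and f_left: "\<And>u. u \<in> Domain E \<Longrightarrow> (\<Sum>v<N. f u v) = 1"
    and f_right: "\<And>v. v < N \<Longrightarrow> (\<Sum>u\<in>Domain E. f u v) \<le> 1"
  shows "\<exists>v. (u, v) \<in> E \<and> lab v < N"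
proof (rule ccontr)
  assume no: "\<not> ?thesis"
  let ?D = "Domain E"
  have DN: "?D \<subseteq> {..<N}" using E by blast
  then have fin: "finite ?D" by (rule finite_subset) simp
  have own: "own v = Suc u' \<Longrightarrow> u' \<notin> U" "own v = Suc u' \<Longrightarrow> (u', v) \<in> E"
    "own v = Suc u' \<Longrightarrow> (u', v') \<in> E \<Longrightarrow> lab v \<le> Suc (lab v')" for v u' v'
    using inv unfolding auction_inv_def by blast+
  obtain m where m: "\<And>u'. u' \<in> ?D - U \<Longrightarrow> own (m u') = Suc u'"
    using inv unfolding auction_inv_def by metis
  have UD: "U \<subseteq> ?D" using inv by (rule auction_inv_free)
  have inj: "inj_on m (?D - U)" by (rule inj_onI) (metis m nat.inject)
  \<comment> \<open>The average label that \<open>u'\<close> sees under the fractional matching; a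
    lower bound on all labels of neighbours is one on this average.\<close>
  define g where "g u' = (\<Sum>v<N. f u' v * lab v)" for u'
  have avg: "c \<le> g u'" if "u' \<in> ?D" "\<And>v. (u', v) \<in> E \<Longrightarrow> c \<le> real (lab v)" for u' c
  proof -
    have "c = (\<Sum>v<N. f u' v * c)" using f_left[OF that(1)] by (simp flip: sum_distrib_right)
    also have "\<dots> \<le> g u'" unfolding g_def
      using that(2) f_supp f_nonneg by (intro sum_mono) (metis mult_left_mono mult_zero_left order_refl)
    finally show ?thesis .
  qed
  have "sum g ?D = (\<Sum>v<N. (\<Sum>u'\<in>?D. f u' v) * lab v)"
    unfolding g_def by (subst sum.swap) (simp add: sum_distrib_right)
  also have "\<dots> \<le> (\<Sum>v<N. real (lab v))"
    using f_right by (intro sum_mono mult_left_le_one_le sum_nonneg f_nonneg) auto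
  \<comment> \<open>Unowned nodes have label zero, so only the nodes held by matched left nodes
    contribute.\<close>
  also have "\<dots> = (\<Sum>v\<in>m ` (?D - U). real (lab v))"
  proof (rule sum.mono_neutral_right)
    show "m ` (?D - U) \<subseteq> {..<N}" using own(2)[OF m] E by blast
    show "\<forall>v\<in>{..<N} - m ` (?D - U). real (lab v) = 0"
    proof
      fix v assume v: "v \<in> {..<N} - m ` (?D - U)"
      have "own v = 0"
      proof (cases "own v")
        case (Suc u')
        then have u': "u' \<in> ?D - U" using own(1,2) by blast
        then have "m u' = v" using m[OF u'] Suc inv unfolding auction_inv_def by blast
        then show ?thesis using u' v by blast
      qed
      then have "lab v = 0" by (rule auction_inv_unowned[OF inv])
      then show "real (lab v) = 0" by simp
    qed
  qed auto
  also have "\<dots> = (\<Sum>u'\<in>?D - U. real (lab (m u')))"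
    using inj by (simp add: sum.reindex)
  also have "\<dots> \<le> (\<Sum>u'\<in>?D - U. g u' + 1)"
  proof (rule sum_mono)
    fix u' assume u': "u' \<in> ?D - U"
    have "real (lab (m u')) - 1 \<le> g u'"
    proof (rule avg)
      show "real (lab (m u')) - 1 \<le> real (lab v)" if "(u', v) \<in> E" for v
        using own(3)[OF m[OF u'] that] by simp
    qed (use u' in blast)
    then show "real (lab (m u')) \<le> g u' + 1" by simp
  qed
  also have "\<dots> = sum g (?D - U) + card (?D - U)" by (simp add: sum.distrib)
  finally have le: "sum g ?D \<le> sum g (?D - U) + card (?D - U)" .
  \<comment> \<open>Without a cheap neighbour the average of \<open>u\<close> alone reaches
    \<open>N\<close>. But the averages of all unmatched nodes together amount to at most the number
    of matched ones, which is below \<open>N\<close> because \<open>u\<close> is not among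
    them.\<close>
  have "real N \<le> g u" using no u UD by (intro avg) (auto simp: not_less)
  also have "g u \<le> sum g U"
    using finite_subset[OF UD fin] u f_nonneg by (intro member_le_sum) (auto simp: g_def intro!: sum_nonneg)
  also have "sum g U = sum g ?D - sum g (?D - U)"
    using sum.subset_diff[OF UD fin, of g] by simp
  also have "\<dots> \<le> card (?D - U)" using le by simp
  finally have "N \<le> card (?D - U)" by simp
  also have "\<dots> < card ?D" using fin UD u by (intro psubset_card_mono) blast+
  also have "\<dots> \<le> N" using card_mono[OF _ DN] by simp
  finally show False by simp
qed

section \<open>Fractional prefixes cut into unit slots\<close>

text \<open>Strict linear order by decreasing key, ties broken by index. Equality of keys is
  expressed by negated strict comparisons, the only test on numbers that the machine has.\<close>

definition before :: "(nat \<Rightarrow> real) \<Rightarrow> nat \<Rightarrow> nat \<Rightarrow> bool" where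
  "before key k' k \<longleftrightarrow> key k < key k' \<or> \<not> key k' < key k \<and> k' < k"

definition prefix_mass :: "nat \<Rightarrow> (nat \<Rightarrow> real) \<Rightarrow> (nat \<Rightarrow> real) \<Rightarrow> nat \<Rightarrow> real" where
  "prefix_mass n key v k = (\<Sum>k'<n. if before key k' k then v k' else 0)"

text \<open>The items are laid out one after another on the half-line, in decreasing order of their keys;
  item \<open>k\<close> occupies an interval of length \<open>v k\<close>. Slot \<open>s\<close> is the interval from \<open>s\<close> to \<open>s + 1\<close>.\<close>

definition meets :: "nat \<Rightarrow> (nat \<Rightarrow> real) \<Rightarrow> (nat \<Rightarrow> real) \<Rightarrow> nat \<Rightarrow> nat \<Rightarrow> bool" where
  "meets n key v k s \<longleftrightarrow> 0 < v k \<and> prefix_mass n key v k < real s + 1 \<and>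
     real s < prefix_mass n key v k + v k"

definition clamp :: "real \<Rightarrow> real" where
  "clamp z = max 0 (min 1 z)"

text \<open>Length of the overlap of item \<open>k\<close> with slot \<open>s\<close>. For
  \<open>z \<ge> 0\<close>, \<open>clamp (z - s)\<close> is the overlap of the slot with the
  interval from \<open>0\<close> to \<open>z\<close>, so the difference of the values at both ends
  of the item is taken; in this form sums over consecutive items telescope.\<close>

definition part :: "nat \<Rightarrow> (nat \<Rightarrow> real) \<Rightarrow> (nat \<Rightarrow> real) \<Rightarrow> nat \<Rightarrow> nat \<Rightarrow> real" where
  "part n key v k s = clamp (prefix_mass n key v k + v k - s) - clamp (prefix_mass n key v k - s)"

lemma clamp_mono: "a \<le> b \<Longrightarrow> clamp a \<le> clamp b"
  and clamp_le_1: "clamp a \<le> 1"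
  and clamp_nonneg: "0 \<le> clamp a"
  by (auto simp: clamp_def)

lemma sum_clamp: "0 \<le> z \<Longrightarrow> z \<le> real n \<Longrightarrow> (\<Sum>s<n. clamp (z - real s)) = z"
proof (induction n arbitrary: z)
  case (Suc n)
  show ?case
  proof (cases "z \<le> real n")
    case True
    then show ?thesis using Suc.IH[of z] Suc.prems by (simp add: clamp_def)
  next
    case False
    have "(\<Sum>s<n. clamp (z - real s)) = (\<Sum>s<n. clamp (real n - real s))"
      using False by (intro sum.cong) (auto simp: clamp_def)
    then show ?thesis using False Suc.prems Suc.IH[of "real n"] by (simp add: clamp_def)
  qed
qed simp

locale layout =
  fixes n :: nat and key v :: "nat \<Rightarrow> real"
  assumes v_nonneg: "0 \<le> v k" and v_le_1: "v k \<le> 1"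
begin

abbreviation "pre \<equiv> prefix_mass n key v"
abbreviation "prt \<equiv> part n key v"
abbreviation "hits \<equiv> meets n key v"

lemma pre_nonneg: "0 \<le> pre k"
  unfolding prefix_mass_def by (intro sum_nonneg) (auto simp: v_nonneg)

lemma sum_v_le: "(\<Sum>k<n. v k) \<le> real n"
  using sum_mono[of "{..<n}" v "\<lambda>_. 1"] v_le_1 by simp

lemma pre_add_le:
  assumes "k < n" "\<And>k'. before key k' k \<or> k' = k \<Longrightarrow> Q k'"
  shows "pre k + v k \<le> (\<Sum>k'<n. if Q k' then v k' else 0)"
proof -
  have "v k = (\<Sum>k'<n. if k' = k then v k' else 0)"
    using assms(1) by (simp add: sum.delta)
  then have "pre k + v k = (\<Sum>k'<n. (if before key k' k then v k' else 0) + (if k' = k then v k' else 0))"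
    unfolding prefix_mass_def by (simp only: sum.distrib)
  also have "\<dots> \<le> (\<Sum>k'<n. if Q k' then v k' else 0)"
    using assms(2) by (intro sum_mono) (auto simp: before_def v_nonneg)
  finally show ?thesis .
qed

lemma pre_add_le_sum: "k < n \<Longrightarrow> pre k + v k \<le> (\<Sum>k<n. v k)"
  using pre_add_le[of k "\<lambda>_. True"] by simp

lemma pre_before:
  assumes "k' < n" "before key k' k"
  shows "pre k' + v k' \<le> pre k"
  unfolding prefix_mass_def[of n key v k] using assms
  by (intro pre_add_le[unfolded prefix_mass_def, folded prefix_mass_def]) (auto simp: before_def)

lemma part_nonneg: "0 \<le> prt k s"
  unfolding part_def using v_nonneg[of k] by (simp add: clamp_mono)

lemma part_zero_unless_meets: "\<not> hits k s \<Longrightarrow> prt k s = 0"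
  using v_nonneg[of k] unfolding part_def meets_def clamp_def by auto

text \<open>Otherwise \<open>k'\<close> would end before \<open>k\<close> begins, hence before the
  end of slot \<open>s\<close>, and could not reach the later slot \<open>s'\<close>.\<close>

lemma key_decreasing:
  assumes "k < n" "k' < n" "hits k s" "hits k' s'" "s < s'"
  shows "key k' \<le> key k"
proof (rule ccontr)
  assume "\<not> ?thesis"
  then have "pre k' + v k' \<le> pre k"
    using assms by (intro pre_before) (auto simp: before_def)
  with assms show False unfolding meets_def by (auto simp: less_le_not_le)
qed

lemma sum_part_slots: "k < n \<Longrightarrow> (\<Sum>s<n. prt k s) = v k"
  using pre_nonneg[of k] v_nonneg[of k] pre_add_le_sum[of k] sum_v_le
  unfolding part_def sum_subtractf
  by (simp add: sum_clamp)

text \<open>An initial segment of the order fills the interval from \<open>0\<close> to its total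
  weight. Induction removes its last item, whose prefix is exactly the rest, and the clamped values
  telescope.\<close>

lemma sum_clamp_interval:
  assumes "finite A" "A \<subseteq> {..<n}"
    and "\<And>k k'. k \<in> A \<Longrightarrow> k' < n \<Longrightarrow> before key k' k \<Longrightarrow> k' \<in> A"
  shows "(\<Sum>k\<in>A. prt k s) = clamp ((\<Sum>k\<in>A. v k) - s)"
  using assms
proof (induction "card A" arbitrary: A)
  case 0
  then show ?case by (simp add: clamp_def)
next
  case (Suc m)
  then have "A \<noteq> {}" by auto
  have irr: "\<not> before key k k" for k by (auto simp: before_def)
  have tr: "before key a c" if "before key a b" "before key b c" for a b c
    using that by (auto simp: before_def)
  have tot: "before key a b \<or> a = b \<or> before key b a" for a b
    by (auto simp: before_def)
  obtain k where k: "k \<in> A" "\<And>k'. k' \<in> A \<Longrightarrow> \<not> before key k k'"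
  proof -
    have "\<exists>k\<in>A. \<forall>k'\<in>A. before key k k' \<longrightarrow> k' = k"
      using \<open>finite A\<close> \<open>A \<noteq> {}\<close>
    proof (induction rule: finite_ne_induct)
      case (insert a A)
      then obtain k where k: "k \<in> A" "\<forall>k'\<in>A. before key k k' \<longrightarrow> k' = k" by blast
      show ?case
      proof (cases "before key k a")
        case True
        then show ?thesis using k tr irr by (intro bexI[of _ a]) blast+
      next
        case False
        then show ?thesis using k by blast
      qed
    qed simp
    then show ?thesis using that irr by blast
  qed
  have kn: "k < n" using k Suc by auto
  have eq: "{k'. k' < n \<and> before key k' k} = A - {k}"
    using k Suc.prems tot irr by blast
  have pre: "pre k = (\<Sum>k'\<in>A - {k}. v k')"
    unfolding prefix_mass_def eq[symmetric] by (simp add: sum.If_cases Int_def)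
  have "(\<Sum>k'\<in>A - {k}. prt k' s) = clamp ((\<Sum>k'\<in>A - {k}. v k') - s)"
    using Suc k by (intro Suc(1)) auto
  then have "(\<Sum>k'\<in>A. prt k' s) = clamp (pre k - s) + prt k s"
    using k Suc.prems pre by (simp add: sum.remove)
  also have "\<dots> = clamp ((\<Sum>k\<in>A. v k) - s)"
    unfolding part_def using k Suc.prems pre by (simp add: sum.remove add.commute)
  finally show ?case .
qed

lemma sum_part_items: "(\<Sum>k<n. prt k s) = clamp ((\<Sum>k<n. v k) - s)"
  by (rule sum_clamp_interval) auto

text \<open>The hypothesis says that slot \<open>s\<close> is full; its parts then sum to one and
  the right-hand side is a convex combination of keys.\<close>

lemma key_le_average:
  assumes "0 \<le> (\<Sum>k<n. v k) - Suc s" "\<And>k'. k' < n \<Longrightarrow> hits k' s \<Longrightarrow> c \<le> key k'"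
  shows "c \<le> (\<Sum>k'<n. prt k' s * key k')"
proof -
  have "c = (\<Sum>k'<n. prt k' s * c)"
    using sum_part_items[of s] assms(1) by (simp add: clamp_def flip: sum_distrib_right)
  also have "\<dots> \<le> (\<Sum>k'<n. prt k' s * key k')"
  proof (rule sum_mono)
    fix k' assume "k' \<in> {..<n}"
    then show "prt k' s * c \<le> prt k' s * key k'"
      using assms(2) part_nonneg part_zero_unless_meets[of k' s]
      by (cases "hits k' s") (auto intro: mult_left_mono)
  qed
  finally show ?thesis .
qed

lemma average_le_key:
  assumes "0 \<le> c" "\<And>k'. k' < n \<Longrightarrow> hits k' s \<Longrightarrow> key k' \<le> c"
  shows "(\<Sum>k'<n. prt k' s * key k') \<le> c"
proof -
  have "(\<Sum>k'<n. prt k' s * key k') \<le> (\<Sum>k'<n. prt k' s * c)"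
  proof (rule sum_mono)
    fix k' assume "k' \<in> {..<n}"
    then show "prt k' s * key k' \<le> prt k' s * c"
      using assms(2) part_nonneg part_zero_unless_meets[of k' s]
      by (cases "hits k' s") (auto intro: mult_left_mono)
  qed
  also have "\<dots> = clamp ((\<Sum>k<n. v k) - s) * c"
    using sum_part_items[of s] by (simp flip: sum_distrib_right)
  also have "\<dots> \<le> c" using assms(1) by (intro mult_left_le_one_le) (auto simp: clamp_le_1 clamp_nonneg)
  finally show ?thesis .
qed

lemma slot_exchange:
  "(\<Sum>s<n. \<Sum>k<n. prt k s * key k) = (\<Sum>k<n. v k * key k)"
  by (subst sum.swap) (simp add: sum_part_slots flip: sum_distrib_right)

text \<open>The Shmoys-Tardos shift: an item chosen from slot \<open>s + 1\<close> has a key no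
  larger than any key in slot \<open>s\<close>, hence at most the average over that slot. Only the
  item chosen from slot \<open>0\<close> has no predecessor and costs the extra
  \<open>c\<close>.\<close>

lemma selection_upper_bound:
  assumes E: "E \<subseteq> {..<n}" and slot: "inj_on slot E"
    "\<And>k. k \<in> E \<Longrightarrow> slot k < n" "\<And>k. k \<in> E \<Longrightarrow> hits k (slot k)"
    and key: "\<And>k. k < n \<Longrightarrow> 0 \<le> key k" "\<And>k. k \<in> E \<Longrightarrow> key k \<le> c" and "0 \<le> c"
  shows "(\<Sum>k\<in>E. key k) \<le> (\<Sum>k<n. v k * key k) + c"
proof -
  have fin: "finite E" using E finite_subset by blast
  define E0 where "E0 = {k \<in> E. slot k = 0}"
  define avg where "avg s = (\<Sum>k'<n. prt k' s * key k')" for s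
  have avg_nonneg: "0 \<le> avg s" for s
    unfolding avg_def using key part_nonneg by (intro sum_nonneg mult_nonneg_nonneg) auto
  have "(\<Sum>k\<in>E0. key k) \<le> c"
  proof (cases "E0 = {}")
    case False
    then obtain k where "k \<in> E0" by blast
    then have "E0 = {k}" using slot unfolding E0_def inj_on_def by fastforce
    moreover have "k \<in> E" using \<open>k \<in> E0\<close> unfolding E0_def by simp
    ultimately show ?thesis using key by simp
  qed (use \<open>0 \<le> c\<close> in simp)
  moreover have "(\<Sum>k\<in>E - E0. key k) \<le> (\<Sum>k\<in>E - E0. avg (slot k - 1))"
  proof (rule sum_mono)
    fix k assume k: "k \<in> E - E0"
    then have kn: "k < n" and hit: "hits k (slot k)" and pos: "0 < slot k"
      using E slot unfolding E0_def by auto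
    show "key k \<le> avg (slot k - 1)"
      unfolding avg_def
    proof (rule key_le_average)
      \<comment> \<open>The item reaches beyond the left end of its slot, so the preceding slot is
        full.\<close>
      show "0 \<le> (\<Sum>k<n. v k) - Suc (slot k - 1)"
        using pre_add_le_sum[OF kn] hit pos unfolding meets_def by auto
      show "key k \<le> key k'" if "k' < n" "hits k' (slot k - 1)" for k'
        using key_decreasing[OF that(1) kn that(2) hit] pos by simp
    qed
  qed
  moreover have "(\<Sum>k\<in>E - E0. avg (slot k - 1)) = (\<Sum>s\<in>(\<lambda>k. slot k - 1) ` (E - E0). avg s)"
  proof (subst sum.reindex)
    show "inj_on (\<lambda>k. slot k - 1) (E - E0)"
    proof (rule inj_onI)
      fix k k' assume "k \<in> E - E0" "k' \<in> E - E0" "slot k - 1 = slot k' - 1"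
      then have "k \<in> E" "k' \<in> E" "slot k = slot k'" unfolding E0_def by auto
      then show "k = k'" using slot(1) by (blast dest: inj_onD)
    qed
  qed simp
  moreover have "(\<Sum>s\<in>(\<lambda>k. slot k - 1) ` (E - E0). avg s) \<le> (\<Sum>s<n. avg s)"
    using slot(2) avg_nonneg by (intro sum_mono2) (auto simp: less_imp_diff_less)
  moreover have "(\<Sum>s<n. avg s) = (\<Sum>k<n. v k * key k)"
    unfolding avg_def by (rule slot_exchange)
  moreover have "(\<Sum>k\<in>E. key k) = (\<Sum>k\<in>E0. key k) + (\<Sum>k\<in>E - E0. key k)"
    using sum.subset_diff[of E0 E key] fin unfolding E0_def by (simp add: add.commute)
  ultimately show ?thesis by linarith
qed

text \<open>The same shift in the other direction: the item chosen from a full slot \<open>t\<close>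
  dominates the average of slot \<open>t + 1\<close>, including a last, partly filled slot. Only the
  average of slot \<open>0\<close>, at most one, remains uncovered.\<close>

lemma selection_lower_bound:
  assumes E: "E \<subseteq> {..<n}" and A: "A = {t. t < n \<and> real t + 1 \<le> (\<Sum>k<n. v k)}"
    and item: "inj_on item A" "\<And>t. t \<in> A \<Longrightarrow> item t \<in> E" "\<And>t. t \<in> A \<Longrightarrow> hits (item t) t"
    and key: "\<And>k. k < n \<Longrightarrow> 0 \<le> key k" "\<And>k. k < n \<Longrightarrow> key k \<le> 1"
  shows "(\<Sum>k<n. v k * key k) - 1 \<le> (\<Sum>k\<in>E. key k)"
proof -
  have finA: "finite A" unfolding A by simp
  have finE: "finite E" using E finite_subset by blast
  define avg where "avg s = (\<Sum>k'<n. prt k' s * key k')" for s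
  have avg_nonneg: "0 \<le> avg s" for s
    unfolding avg_def using key part_nonneg by (intro sum_nonneg mult_nonneg_nonneg) auto
  have avg_zero: "avg s = 0" if "(\<Sum>k<n. v k) \<le> s" for s
    unfolding avg_def
  proof (rule sum.neutral, rule ballI)
    fix k assume k: "k \<in> {..<n}"
    then have "\<not> hits k s" using pre_add_le_sum[of k] that unfolding meets_def by auto
    then show "prt k s * key k = 0" by (simp add: part_zero_unless_meets)
  qed
  have "avg 0 \<le> 1" unfolding avg_def using key by (intro average_le_key) auto
  \<comment> \<open>One slot is appended so that splitting off slot \<open>0\<close> leaves the
    averages of \<open>Suc s\<close> for all \<open>s < n\<close>.\<close>
  have "(\<Sum>s<n. avg s) \<le> (\<Sum>s<Suc n. avg s)" using avg_nonneg by simp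
  also have "\<dots> = avg 0 + (\<Sum>s<n. avg (Suc s))" by (rule sum.lessThan_Suc_shift)
  \<comment> \<open>If slot \<open>s\<close> is not full, the layout ends inside or before it and
    slot \<open>Suc s\<close> is empty.\<close>
  also have "(\<Sum>s<n. avg (Suc s)) = (\<Sum>s\<in>A. avg (Suc s))"
    unfolding A by (rule sum.mono_neutral_right) (auto intro!: avg_zero)
  also have "\<dots> \<le> (\<Sum>t\<in>A. key (item t))"
  proof (rule sum_mono)
    fix t assume t: "t \<in> A"
    then have it: "item t < n" "hits (item t) t" using item E by auto
    show "avg (Suc t) \<le> key (item t)"
      unfolding avg_def using key it key_decreasing[OF it(1) _ it(2)]
      by (intro average_le_key) auto
  qed
  also have "\<dots> = (\<Sum>k\<in>item ` A. key k)" using item(1) by (simp add: sum.reindex)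
  also have "\<dots> \<le> (\<Sum>k\<in>E. key k)"
    using item finE E key by (intro sum_mono2) auto
  finally have "(\<Sum>s<n. avg s) \<le> avg 0 + (\<Sum>k\<in>E. key k)" by simp
  moreover have "(\<Sum>s<n. avg s) = (\<Sum>k<n. v k * key k)"
    unfolding avg_def by (rule slot_exchange)
  ultimately show ?thesis using \<open>avg 0 \<le> 1\<close> by linarith
qed

end

section \<open>The matching instance\<close>

lemma sum_lessThan_add: "(\<Sum>v<m + k. h v) = (\<Sum>v<m. h v) + (\<Sum>v<k. h (m + v) :: 'a :: comm_monoid_add)"
  for m k :: nat
  by (induction k) (simp_all add: add.assoc)

lemma sum_lessThan_mult:
  "(\<Sum>u<m * n. h u) = (\<Sum>a<m. \<Sum>b<n. h (a * n + b) :: 'a :: comm_monoid_add)" for m n :: nat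
proof (induction m)
  case (Suc m)
  then show ?case using sum_lessThan_add[of h "m * n" n] by (simp add: add.commute)
qed simp

lemma code_less: "a < m \<Longrightarrow> b < n \<Longrightarrow> a * n + b < m * n" for a b m n :: nat
proof -
  assume "a < m" "b < n"
  then have "a * n + b < Suc a * n" by simp
  also have "\<dots> \<le> m * n" using \<open>a < m\<close> by (intro mult_le_mono1) simp
  finally show ?thesis .
qed

lemma code_eq_iff: "b < n \<Longrightarrow> b' < n \<Longrightarrow> a * n + b = a' * n + b' \<longleftrightarrow> a = a' \<and> b = b'"
  for a b a' b' n :: nat
  by (metis div_mult_self3 mod_mult_self3 div_less add_0_right mod_less not_less_zero)

text \<open>Facilities and clients are merged into one range of \<open>n\<close> points by extending
  the data with zeros. Columns of points that are not clients then sum to zero, so the column sums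
  are only bounded by one here.\<close>

locale rounding_instance =
  fixes n :: nat and X D :: "nat \<Rightarrow> nat \<Rightarrow> real" and Y :: "nat \<Rightarrow> real" and \<gamma> T :: real
  assumes gamma: "0 < \<gamma>" "\<gamma> < 1" and T_pos: "0 < T"
    and X_nonneg: "0 \<le> X i j" and X_le_Y: "X i j \<le> Y i" and Y_le_1: "Y i \<le> 1"
    and D_nonneg: "0 \<le> D i j" and D_le_T: "X i j \<noteq> 0 \<Longrightarrow> D i j \<le> T"
    and sum_X_le_1: "(\<Sum>i<n. X i j) \<le> 1"
begin

definition big :: "nat \<Rightarrow> nat \<Rightarrow> bool" where
  "big i j \<longleftrightarrow> \<not> X i j < \<gamma> * Y i"

definition w :: "nat \<Rightarrow> nat \<Rightarrow> real" where
  "w i j = (if 0 < X i j \<and> X i j < \<gamma> * Y i then X i j / (\<gamma> * Y i) else 0)"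

definition client_mass :: "nat \<Rightarrow> real" where
  "client_mass j = (\<Sum>i<n. w i j)"

abbreviation meets_slot :: "nat \<Rightarrow> nat \<Rightarrow> nat \<Rightarrow> bool" where
  "meets_slot i j s \<equiv> meets n (D i) (w i) j s"

abbreviation meets_unit :: "nat \<Rightarrow> nat \<Rightarrow> nat \<Rightarrow> bool" where
  "meets_unit i j t \<equiv> meets n Y (\<lambda>i. w i j) i t"

text \<open>The offset separates pairs from slots. Both copies of a pair share one number, since
  left and right nodes are never mixed.\<close>

definition enode :: "nat \<Rightarrow> nat \<Rightarrow> nat" where
  "enode i j = n * n + (i * n + j)"

text \<open>The bound \<open>m\<close> on slot numbers makes the edge set a loop invariant for the
  loop over slots; the full set is obtained for \<open>m = n\<close>. Client slots that are not full
  get no edges, because they need not be saturated.\<close>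

definition adjacent :: "nat \<Rightarrow> nat \<Rightarrow> nat \<Rightarrow> (nat \<times> nat) set" where
  "adjacent m i j =
     {(enode i j, i * n + s) |s. s < m \<and> meets_slot i j s} \<union>
     {(j * n + t, enode i j) |t. t < m \<and> meets_unit i j t \<and> real t + 1 \<le> client_mass j}"

text \<open>The left nodes are the full unit slots \<open>j * n + t\<close> of the clients \<open>j\<close> and the pairs \<open>(i, j)\<close>,
  the right nodes are the slots \<open>i * n + s\<close> of the facilities \<open>i\<close> and again the pairs. A pair
  matched to itself is not selected; a pair matched to a slot of its facility is selected, and its
  right copy becomes available for a slot of its client.\<close>

definition graph :: "(nat \<times> nat) set" where
  "graph = (\<Union>i<n. \<Union>j<n. insert (enode i j, enode i j) (adjacent n i j))"

text \<open>Edges between pairs and slots carry the overlap \<open>part\<close> of the respective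
  layout. The edge between the two copies of a pair carries the remainder \<open>1 - w i j\<close>,
  so a left copy is spread over it and the slots of its facility.\<close>

definition fractional :: "nat \<Rightarrow> nat \<Rightarrow> real" where
  "fractional u v =
     (if u < n * n then
        (let j = u div n; t = u mod n; i = (v - n * n) div n in
         if n * n \<le> v \<and> v < n * n + n * n \<and> (v - n * n) mod n = j \<and> real t + 1 \<le> client_mass j
         then part n Y (\<lambda>i. w i j) i t else 0)
      else if u < n * n + n * n then
        (let i = (u - n * n) div n; j = (u - n * n) mod n in
         if v = u then 1 - w i j
         else if v < n * n \<and> v div n = i then part n (D i) (w i) j (v mod n) else 0)
      else 0)"

lemma Y_nonneg: "0 \<le> Y i"
  using X_nonneg X_le_Y by (rule order_trans)

lemma w_nonneg: "0 \<le> w i j" and w_le_1: "w i j \<le> 1"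
  using X_nonneg[of i j] by (auto simp: w_def)

lemma w_pos: "0 < w i j \<Longrightarrow> 0 < X i j \<and> \<not> big i j"
  by (auto simp: w_def big_def split: if_splits)

sublocale slots: layout n "D i" "w i" for i
  by unfold_locales (auto simp: w_nonneg w_le_1)

sublocale units: layout n Y "\<lambda>i. w i j" for j
  by unfold_locales (auto simp: w_nonneg w_le_1)

lemma node_less: "i < n \<Longrightarrow> j < n \<Longrightarrow> i * n + j < n * n"
  by (rule code_less)

lemma enode_less: "i < n \<Longrightarrow> j < n \<Longrightarrow> enode i j < n * n + n * n"
  unfolding enode_def using node_less by simp

lemma enode_eq_iff: "j < n \<Longrightarrow> j' < n \<Longrightarrow> enode i j = enode i' j' \<longleftrightarrow> i = i' \<and> j = j'"
  unfolding enode_def by (simp add: code_eq_iff)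

lemma node_neq_enode: "i < n \<Longrightarrow> s < n \<Longrightarrow> i * n + s \<noteq> enode i' j'"
  unfolding enode_def using node_less[of i s] by linarith

lemma graph_bounds: "graph \<subseteq> {..<n * n + n * n} \<times> {..<n * n + n * n}"
  unfolding graph_def adjacent_def using enode_less node_less by (auto simp: trans_less_add1)

lemma graph_from_enode:
  assumes "i < n" "j < n" "(enode i j, v) \<in> graph"
  shows "v = enode i j \<or> (\<exists>s<n. v = i * n + s \<and> meets_slot i j s)"
  using assms unfolding graph_def adjacent_def
  by (auto simp: enode_eq_iff node_neq_enode node_neq_enode[symmetric])

lemma graph_from_unit:
  assumes "j < n" "t < n" "(j * n + t, v) \<in> graph"
  shows "\<exists>i<n. v = enode i j \<and> meets_unit i j t \<and> real t + 1 \<le> client_mass j"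
  using assms unfolding graph_def adjacent_def
  by (auto simp: code_eq_iff node_neq_enode)

lemma enode_in_Domain: "i < n \<Longrightarrow> j < n \<Longrightarrow> enode i j \<in> Domain graph"
  unfolding graph_def by blast

lemma Domain_graph_cases:
  assumes "u \<in> Domain graph"
  obtains i j where "i < n" "j < n" "u = enode i j"
  | j t where "j < n" "t < n" "u = j * n + t" "real t + 1 \<le> client_mass j"
  using assms unfolding graph_def adjacent_def by auto

text \<open>The parts in a full slot sum to one, so one of them is nonzero and provides an
  edge.\<close>

lemma node_in_Domain:
  assumes "j < n" "t < n" "real t + 1 \<le> client_mass j"
  shows "j * n + t \<in> Domain graph"
proof -
  have "(\<Sum>i<n. part n Y (\<lambda>i. w i j) i t) = 1"
    using assms units.sum_part_items[of j t] by (simp add: clamp_def client_mass_def)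
  then obtain i where "i < n" "part n Y (\<lambda>i. w i j) i t \<noteq> 0"
    by (metis lessThan_iff sum.neutral zero_neq_one)
  then have "meets_unit i j t" using units.part_zero_unless_meets by blast
  then have "(j * n + t, enode i j) \<in> graph"
    using assms \<open>i < n\<close> unfolding graph_def adjacent_def by blast
  then show ?thesis by blast
qed

lemma fractional_unit_node:
  "a < n \<Longrightarrow> b < n \<Longrightarrow> v < n * n \<Longrightarrow> fractional (a * n + b) v = 0"
  by (simp add: fractional_def node_less)

lemma fractional_unit_enode:
  "j < n \<Longrightarrow> t < n \<Longrightarrow> a < n \<Longrightarrow> b < n \<Longrightarrow> fractional (j * n + t) (enode a b) =
     (if b = j \<and> real t + 1 \<le> client_mass j then part n Y (\<lambda>i. w i j) a t else 0)"
  using node_less[of j t] node_less[of a b] by (simp add: fractional_def enode_def)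

lemma fractional_enode_node:
  "i < n \<Longrightarrow> j < n \<Longrightarrow> a < n \<Longrightarrow> b < n \<Longrightarrow> fractional (enode i j) (a * n + b) =
     (if a = i then part n (D i) (w i) j b else 0)"
  using node_less[of i j] node_less[of a b] by (simp add: fractional_def enode_def)

lemma fractional_enode_enode:
  "i < n \<Longrightarrow> j < n \<Longrightarrow> a < n \<Longrightarrow> b < n \<Longrightarrow> fractional (enode i j) (enode a b) =
     (if a = i \<and> b = j then 1 - w i j else 0)"
  using node_less[of i j] node_less[of a b] code_eq_iff[of b n j a i]
  by (simp add: fractional_def enode_def)

lemma fractional_nonneg: "0 \<le> fractional u v"
  unfolding fractional_def Let_def
  using slots.part_nonneg units.part_nonneg w_le_1 by auto

lemma node_cases:
  assumes "u < n * n + n * n"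
  obtains a b where "a < n" "b < n" "u = a * n + b" | a b where "a < n" "b < n" "u = enode a b"
proof (cases "u < n * n")
  case True
  then have "n > 0" by (cases n) auto
  then have "u div n < n" "u mod n < n" using True by (auto simp: less_mult_imp_div_less)
  then show ?thesis using that(1)[of "u div n" "u mod n"] by simp
next
  case False
  then have u: "u - n * n < n * n" using assms by simp
  then have "n > 0" by (cases n) auto
  then have "(u - n * n) div n < n" "(u - n * n) mod n < n" using u by (auto simp: less_mult_imp_div_less)
  then show ?thesis using that(2)[of "(u - n * n) div n" "(u - n * n) mod n"] False
    by (simp add: enode_def)
qed

lemma fractional_supported:
  assumes "(u, v) \<notin> graph"
  shows "fractional u v = 0"
proof (cases "u < n * n + n * n \<and> v < n * n + n * n")
  case False
  then show ?thesis by (auto simp: fractional_def Let_def)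
next
  case True
  then have uv: "u < n * n + n * n" "v < n * n + n * n" by auto
  from uv(1) show ?thesis
  proof (cases rule: node_cases)
    case u: (1 j t)
    from uv(2) show ?thesis
    proof (cases rule: node_cases)
      case (1 a b)
      then show ?thesis using u fractional_unit_node node_less by simp
    next
      case v: (2 a b)
      show ?thesis
      proof (rule ccontr)
        assume "fractional u v \<noteq> 0"
        then have "b = j" "real t + 1 \<le> client_mass j" "part n Y (\<lambda>i. w i j) a t \<noteq> 0"
          using u v by (auto simp: fractional_unit_enode split: if_splits)
        then have "meets_unit a j t" using units.part_zero_unless_meets by blast
        then have "(u, v) \<in> graph" using u v \<open>b = j\<close> \<open>real t + 1 \<le> client_mass j\<close>
          unfolding graph_def adjacent_def by blast
        with assms show False by blast
      qed
    qed
  next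
    case u: (2 i j)
    from uv(2) show ?thesis
    proof (cases rule: node_cases)
      case v: (1 a s)
      show ?thesis
      proof (rule ccontr)
        assume "fractional u v \<noteq> 0"
        then have "a = i" "part n (D i) (w i) j s \<noteq> 0"
          using u v by (auto simp: fractional_enode_node split: if_splits)
        then have "meets_slot i j s" using slots.part_zero_unless_meets by blast
        then have "(u, v) \<in> graph" using u v \<open>a = i\<close>
          unfolding graph_def adjacent_def by blast
        with assms show False by blast
      qed
    next
      case v: (2 a b)
      then show ?thesis using u assms unfolding graph_def
        by (auto simp: fractional_enode_enode)
    qed
  qed
qed

lemma sum_nodes:
  "(\<Sum>v<n * n + n * n. h v) = (\<Sum>a<n. \<Sum>b<n. h (a * n + b)) + (\<Sum>a<n. \<Sum>b<n. h (enode a b))"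
  for h :: "nat \<Rightarrow> real"
  unfolding sum_lessThan_add sum_lessThan_mult enode_def ..

lemma fractional_left:
  assumes "u \<in> Domain graph"
  shows "(\<Sum>v<n * n + n * n. fractional u v) = 1"
  using assms
proof (cases rule: Domain_graph_cases)
  case (1 i j)
  then have "(\<Sum>a<n. \<Sum>b<n. fractional u (a * n + b)) =
      (\<Sum>a<n. if a = i then \<Sum>b<n. part n (D i) (w i) j b else 0)"
    by (intro sum.cong) (auto simp: fractional_enode_node)
  also have "\<dots> = w i j" using 1 by (simp add: slots.sum_part_slots)
  finally have a: "(\<Sum>a<n. \<Sum>b<n. fractional u (a * n + b)) = w i j" .
  have "(\<Sum>a<n. \<Sum>b<n. fractional u (enode a b)) =
      (\<Sum>a<n. if a = i then \<Sum>b<n. if b = j then 1 - w i j else 0 else 0)"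
    using 1 by (intro sum.cong) (auto simp: fractional_enode_enode)
  also have "\<dots> = 1 - w i j" using 1 by simp
  finally show ?thesis using a by (simp add: sum_nodes)
next
  case (2 j t)
  have "(\<Sum>a<n. \<Sum>b<n. fractional u (a * n + b)) = 0"
    using 2 by (intro sum.neutral ballI) (simp add: fractional_unit_node node_less)
  moreover have "(\<Sum>a<n. \<Sum>b<n. fractional u (enode a b)) =
      (\<Sum>a<n. \<Sum>b<n. if b = j then part n Y (\<lambda>i. w i j) a t else 0)"
    using 2 by (intro sum.cong) (auto simp: fractional_unit_enode)
  moreover have "\<dots> = (\<Sum>a<n. part n Y (\<lambda>i. w i j) a t)" using 2 by simp
  moreover have "\<dots> = 1"
    using 2 units.sum_part_items[of j t] by (simp add: clamp_def client_mass_def)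
  ultimately show ?thesis by (simp add: sum_nodes)
qed

text \<open>A right copy receives \<open>1 - w i j\<close> from its left copy and at most
  \<open>w i j\<close> from the client slots; less is possible because only full slots occur on the
  left. A facility slot receives its total overlap, at most one.\<close>

lemma fractional_right:
  assumes "v < n * n + n * n"
  shows "(\<Sum>u\<in>Domain graph. fractional u v) \<le> 1"
proof -
  have "(\<Sum>u\<in>Domain graph. fractional u v) \<le> (\<Sum>u<n * n + n * n. fractional u v)"
    using graph_bounds by (intro sum_mono2) (auto simp: fractional_nonneg)
  also have "\<dots> \<le> 1"
    using assms
  proof (cases rule: node_cases)
    case (1 i s)
    have "(\<Sum>a<n. \<Sum>b<n. fractional (a * n + b) v) = 0"
      using 1 by (intro sum.neutral ballI) (simp add: fractional_unit_node node_less)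
    moreover have "(\<Sum>a<n. \<Sum>b<n. fractional (enode a b) v) =
        (\<Sum>a<n. if a = i then \<Sum>b<n. part n (D i) (w i) b s else 0)"
      using 1 by (intro sum.cong) (auto simp: fractional_enode_node intro!: sum.neutral)
    moreover have "\<dots> = (\<Sum>b<n. part n (D i) (w i) b s)" using 1 by simp
    moreover have "\<dots> \<le> 1" by (simp add: slots.sum_part_items clamp_le_1)
    ultimately show ?thesis by (simp add: sum_nodes)
  next
    case (2 i j)
    have "(\<Sum>a<n. \<Sum>b<n. fractional (a * n + b) v) \<le>
        (\<Sum>a<n. if a = j then \<Sum>b<n. part n Y (\<lambda>i. w i j) i b else 0)"
      using 2 by (intro sum_mono) (auto simp: fractional_unit_enode units.part_nonneg
          intro!: sum_mono sum_nonpos)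
    also have "\<dots> = w i j" using 2 by (simp add: units.sum_part_slots)
    finally have "(\<Sum>a<n. \<Sum>b<n. fractional (a * n + b) v) \<le> w i j" .
    moreover have "(\<Sum>a<n. \<Sum>b<n. fractional (enode a b) v) =
        (\<Sum>a<n. if a = i then \<Sum>b<n. if b = j then 1 - w i j else 0 else 0)"
      using 2 by (intro sum.cong) (auto simp: fractional_enode_enode)
    moreover have "\<dots> = 1 - w i j" using 2 by simp
    ultimately show ?thesis by (simp add: sum_nodes)
  qed
  finally show ?thesis .
qed

lemma auction_progress:
  assumes "auction_inv graph (n * n + n * n) U own lab" "u \<in> U"
  shows "\<exists>v. (u, v) \<in> graph \<and> lab v < n * n + n * n"
  using auction_has_cheap_neighbour[OF assms(1) graph_bounds assms(2), of fractional]
    fractional_nonneg fractional_supported fractional_left fractional_right by blast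

end

section \<open>From a matching to the rounded solution\<close>

locale matched_instance = rounding_instance +
  fixes own lab :: "nat \<Rightarrow> nat"
  assumes matching: "auction_inv graph (n * n + n * n) {} own lab"
begin

text \<open>Read off the right copy, as \<open>own\<close> is indexed by right nodes. A left copy
  that does not own it must, being matched, own a slot of its facility.\<close>

definition selected :: "nat \<Rightarrow> nat \<Rightarrow> bool" where
  "selected i j \<longleftrightarrow> own (enode i j) \<noteq> Suc (enode i j)"

lemma own_edge: "own v = Suc u \<Longrightarrow> (u, v) \<in> graph"
  and own_ex: "u \<in> Domain graph \<Longrightarrow> \<exists>v. own v = Suc u"
  using matching unfolding auction_inv_def by blast+

lemma selected_slot:
  assumes "i < n" "j < n" "selected i j"
  shows "\<exists>s<n. own (i * n + s) = Suc (enode i j) \<and> meets_slot i j s"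
proof -
  obtain v where v: "own v = Suc (enode i j)" using own_ex enode_in_Domain assms by blast
  then have "v \<noteq> enode i j" using assms unfolding selected_def by auto
  with v graph_from_enode[OF assms(1,2) own_edge[OF v]] show ?thesis by auto
qed

lemma selected_small:
  assumes "i < n" "j < n" "selected i j"
  shows "0 < X i j" "\<not> big i j"
  using selected_slot[OF assms] w_pos unfolding meets_def by auto

text \<open>Facility layout with distances as keys. A slot has a single owner, so the slots of the
  selected clients are distinct; clients farther than \<open>T\<close> have value zero and are never
  selected.\<close>

lemma selected_load:
  assumes "i < n"
  shows "(\<Sum>j | j < n \<and> selected i j. D i j) \<le> (\<Sum>j<n. w i j * D i j) + T"
proof -
  obtain slot where slot: "slot j < n" "own (i * n + slot j) = Suc (enode i j)" "meets_slot i j (slot j)"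
    if "j < n" "selected i j" for j
    using selected_slot[OF assms] by metis
  have inj: "inj_on slot {j. j < n \<and> selected i j}"
  proof (rule inj_onI)
    fix j j' assume j: "j \<in> {j. j < n \<and> selected i j}" "j' \<in> {j. j < n \<and> selected i j}"
      and eq: "slot j = slot j'"
    have "Suc (enode i j) = Suc (enode i j')"
      using slot(2)[of j] slot(2)[of j'] j unfolding eq by simp
    then show "j = j'" using j by (simp add: enode_eq_iff)
  qed
  show ?thesis
  proof (rule slots.selection_upper_bound[OF _ inj])
    show "D i j \<le> T" if "j \<in> {j. j < n \<and> selected i j}" for j
      using selected_small(1)[OF assms, of j] that D_le_T[of i j] by auto
  qed (use slot D_nonneg T_pos in auto)
qed

text \<open>Client layout with the \<open>Y i\<close> as keys. A full slot owns the right copy of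
  some pair, which its left copy therefore does not own, so that pair is selected.\<close>

lemma selected_mass:
  assumes "j < n"
  shows "(\<Sum>i<n. w i j * Y i) - 1 \<le> (\<Sum>i | i < n \<and> selected i j. Y i)"
proof -
  define A where "A = {t. t < n \<and> real t + 1 \<le> (\<Sum>i<n. w i j)}"
  have "\<exists>i. i < n \<and> own (enode i j) = Suc (j * n + t) \<and> meets_unit i j t" if "t \<in> A" for t
  proof -
    have t: "t < n" "real t + 1 \<le> client_mass j" using that by (auto simp: client_mass_def A_def)
    then obtain v where v: "own v = Suc (j * n + t)" using own_ex node_in_Domain assms by blast
    then show ?thesis using graph_from_unit[OF assms t(1) own_edge[OF v]] by auto
  qed
  then obtain item where item: "item t < n" "own (enode (item t) j) = Suc (j * n + t)"
    "meets_unit (item t) j t" if "t \<in> A" for t by metis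
  have inj: "inj_on item A"
  proof (rule inj_onI)
    fix t t' assume t: "t \<in> A" "t' \<in> A" and eq: "item t = item t'"
    show "t = t'" using item(2)[OF t(1)] item(2)[OF t(2)] unfolding eq by simp
  qed
  have sel: "selected (item t) j" if "t \<in> A" for t
    using item(2)[OF that] node_neq_enode[OF assms, of t] that[unfolded A_def] unfolding selected_def by auto
  show ?thesis
    by (rule units.selection_lower_bound[OF _ A_def inj]) (use item sel Y_nonneg Y_le_1 in auto)
qed

text \<open>The small values are added greedily as long as the client total does not exceed one. A
  rejected value certifies that the total already exceeds \<open>1 - \<gamma>\<close>.\<close>

fun total :: "nat \<Rightarrow> nat \<Rightarrow> real" where
  "total j 0 = (\<Sum>i<n. if big i j then X i j else 0)"
| "total j (Suc i) = total j i +
     (if \<not> big i j \<and> selected i j \<and> \<not> 1 < total j i + \<gamma> * Y i then \<gamma> * Y i else 0)"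

definition rounded :: "nat \<Rightarrow> nat \<Rightarrow> real" where
  "rounded i j = (if big i j then X i j
     else if selected i j \<and> \<not> 1 < total j i + \<gamma> * Y i then \<gamma> * Y i else 0)"

lemma rounded_nonneg: "0 \<le> rounded i j"
  using X_nonneg Y_nonneg gamma unfolding rounded_def by auto

lemma rounded_zero: "i < n \<Longrightarrow> j < n \<Longrightarrow> X i j = 0 \<Longrightarrow> rounded i j = 0"
  using selected_small(1)[of i j] unfolding rounded_def by auto

lemma rounded_le: "rounded i j \<le> Y i"
  using X_le_Y Y_nonneg[of i] gamma mult_left_le_one_le[of "Y i" \<gamma>] unfolding rounded_def by auto

lemma rounded_ge: "0 < rounded i j \<Longrightarrow> \<gamma> * Y i \<le> rounded i j"
  unfolding rounded_def big_def by (auto split: if_splits)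

lemma total_eq:
  "total j m = (\<Sum>i<n. if big i j then X i j else 0) + (\<Sum>i<m. if big i j then 0 else rounded i j)"
  by (induction m) (auto simp: rounded_def)

lemma sum_rounded: "(\<Sum>i<n. rounded i j) = total j n"
proof -
  have "(\<Sum>i<n. rounded i j) =
      (\<Sum>i<n. (if big i j then X i j else 0) + (if big i j then 0 else rounded i j))"
    by (intro sum.cong) (auto simp: rounded_def)
  then show ?thesis by (simp add: total_eq sum.distrib)
qed

lemma total_le_1: "total j m \<le> 1"
proof (induction m)
  case 0
  have "total j 0 \<le> (\<Sum>i<n. X i j)"
    unfolding total.simps by (intro sum_mono) (auto simp: X_nonneg)
  then show ?case using sum_X_le_1[of j] by linarith
qed auto

lemma total_mono: "m \<le> m' \<Longrightarrow> total j m \<le> total j m'"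
proof (rule lift_Suc_mono_le)
  show "total j i \<le> total j (Suc i)" for i
    using mult_nonneg_nonneg[of \<gamma> "Y i"] Y_nonneg[of i] gamma by simp
qed

text \<open>If some selected value is rejected, the running total is above
  \<open>1 - \<gamma>\<close>. Otherwise all selected values are kept, and the one unit lost in
  \<open>selected_mass\<close>, scaled by \<open>\<gamma>\<close>, is the whole deficit.\<close>

lemma sum_rounded_ge:
  assumes "j < n"
  shows "(\<Sum>i<n. X i j) - \<gamma> \<le> (\<Sum>i<n. rounded i j)"
proof (cases "\<exists>i<n. selected i j \<and> 1 < total j i + \<gamma> * Y i")
  case True
  then obtain i where i: "i < n" "1 < total j i + \<gamma> * Y i" by blast
  have "\<gamma> * Y i \<le> \<gamma>" using gamma Y_le_1[of i] Y_nonneg[of i] by (simp add: mult_left_le)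
  then show ?thesis using i total_mono[of i n j] sum_X_le_1[of j] by (simp add: sum_rounded)
next
  case False
  have "(\<Sum>i<n. X i j) \<le> (\<Sum>i<n. (if big i j then X i j else 0) + \<gamma> * (w i j * Y i))"
  proof (rule sum_mono)
    fix i show "X i j \<le> (if big i j then X i j else 0) + \<gamma> * (w i j * Y i)"
      using gamma X_nonneg[of i j] Y_nonneg[of i] w_nonneg[of i j]
      by (cases "Y i = 0") (auto simp: big_def w_def)
  qed
  also have "\<dots> = total j 0 + \<gamma> * (\<Sum>i<n. w i j * Y i)"
    by (simp add: sum.distrib sum_distrib_left)
  also have "\<dots> \<le> total j 0 + \<gamma> * ((\<Sum>i | i < n \<and> selected i j. Y i) + 1)"
    using selected_mass[OF assms] gamma by (intro add_left_mono mult_left_mono) auto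
  also have "\<gamma> * ((\<Sum>i | i < n \<and> selected i j. Y i) + 1) =
      (\<Sum>i | i < n \<and> selected i j. \<gamma> * Y i) + \<gamma>"
    by (simp add: sum_distrib_left algebra_simps)
  also have "(\<Sum>i | i < n \<and> selected i j. \<gamma> * Y i) = (\<Sum>i<n. if big i j then 0 else rounded i j)"
  proof -
    have "(\<Sum>i<n. if big i j then 0 else rounded i j) = (\<Sum>i<n. if selected i j then \<gamma> * Y i else 0)"
      using False selected_small(2)[OF _ assms] by (intro sum.cong) (auto simp: rounded_def)
    then show ?thesis by (simp add: sum.If_cases Int_def)
  qed
  finally show ?thesis by (simp add: sum_rounded total_eq)
qed

text \<open>Rejections only lower the load, so all selected pairs may be counted. They share the
  factor \<open>\<gamma> * Y i\<close>, which reduces the small part to the sum of distances in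
  \<open>selected_load\<close>.\<close>

lemma rounded_load:
  assumes "i < n"
  shows "(\<Sum>j<n. D i j * rounded i j) \<le> (\<Sum>j<n. D i j * X i j) + \<gamma> * T * Y i"
proof -
  have "(\<Sum>j<n. D i j * rounded i j) \<le>
      (\<Sum>j<n. (if big i j then D i j * X i j else 0) + (if selected i j then \<gamma> * Y i * D i j else 0))"
    using gamma X_nonneg Y_nonneg D_nonneg by (intro sum_mono) (auto simp: rounded_def)
  also have "\<dots> = (\<Sum>j<n. if big i j then D i j * X i j else 0) +
      \<gamma> * Y i * (\<Sum>j | j < n \<and> selected i j. D i j)"
    by (simp add: sum.distrib sum.If_cases Int_def sum_distrib_left)
  also have "\<dots> \<le> (\<Sum>j<n. if big i j then D i j * X i j else 0) +
      \<gamma> * Y i * ((\<Sum>j<n. w i j * D i j) + T)"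
    using gamma Y_nonneg[of i] selected_load[OF assms] by (intro add_left_mono mult_left_mono) auto
  also have "\<dots> = (\<Sum>j<n. (if big i j then D i j * X i j else 0) + \<gamma> * Y i * (w i j * D i j)) + \<gamma> * T * Y i"
    by (simp add: sum.distrib sum_distrib_left algebra_simps)
  also have "(\<Sum>j<n. (if big i j then D i j * X i j else 0) + \<gamma> * Y i * (w i j * D i j)) \<le>
      (\<Sum>j<n. D i j * X i j)"
    using X_nonneg[of i] D_nonneg[of i] by (intro sum_mono) (auto simp: big_def w_def)
  finally show ?thesis by simp
qed

end

section \<open>The program\<close>

text \<open>Naturals cannot be multiplied, so the numbers \<open>i * n + j\<close> come from a
  counter and are tabulated in \<open>ix\<close>. The final count \<open>n * n\<close> is the offset
  of the pair nodes, and twice the count is the number of nodes.\<close>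

definition weights_com :: com where
  "weights_com = CSeqs [
     set_ivar ''cnt'' (IConst 0),
     CFor ''i'' ''n'' (CFor ''j'' ''n'' (CSeqs [
       CSetI ''ix'' (ivar ''i'') (ivar ''j'') (ivar ''cnt''),
       set_ivar ''cnt'' (IPlus (ivar ''cnt'') (IConst 1)),
       CIf (BAnd (RLess (RConst 0) (RCell ''x'' (ivar ''i'') (ivar ''j'')))
             (RLess (RCell ''x'' (ivar ''i'') (ivar ''j''))
               (RTimes (rvar ''gamma'') (RCell ''y'' (ivar ''i'') (IConst 0)))))
         (CSetR ''w'' (ivar ''i'') (ivar ''j'')
           (RDivide (RCell ''x'' (ivar ''i'') (ivar ''j''))
             (RTimes (rvar ''gamma'') (RCell ''y'' (ivar ''i'') (IConst 0)))))
         (CSetR ''w'' (ivar ''i'') (ivar ''j'') (RConst 0))])),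
     set_ivar ''N'' (IPlus (ivar ''cnt'') (ivar ''cnt'')),
     set_ivar ''N1'' (IPlus (ivar ''N'') (IConst 1))]"

text \<open>\<open>p\<close> and \<open>q\<close> become the left ends of the pair's intervals in
  the layouts of its facility and its client, \<open>m\<close> the mass of the client.\<close>

definition prefix_com :: com where
  "prefix_com = CSeqs [
     set_rvar ''p'' (RConst 0), set_rvar ''q'' (RConst 0), set_rvar ''m'' (RConst 0),
     CFor ''k'' ''n'' (CSeqs [
       CIf (BOr (RLess (RCell ''d'' (ivar ''i'') (ivar ''j'')) (RCell ''d'' (ivar ''i'') (ivar ''k'')))
              (BAnd (BNot (RLess (RCell ''d'' (ivar ''i'') (ivar ''k'')) (RCell ''d'' (ivar ''i'') (ivar ''j''))))
                (ILess (ivar ''k'') (ivar ''j''))))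
         (set_rvar ''p'' (RPlus (rvar ''p'') (RCell ''w'' (ivar ''i'') (ivar ''k''))))
         CSkip,
       CIf (BOr (RLess (RCell ''y'' (ivar ''i'') (IConst 0)) (RCell ''y'' (ivar ''k'') (IConst 0)))
              (BAnd (BNot (RLess (RCell ''y'' (ivar ''k'') (IConst 0)) (RCell ''y'' (ivar ''i'') (IConst 0))))
                (ILess (ivar ''k'') (ivar ''i''))))
         (set_rvar ''q'' (RPlus (rvar ''q'') (RCell ''w'' (ivar ''k'') (ivar ''j''))))
         CSkip,
       set_rvar ''m'' (RPlus (rvar ''m'') (RCell ''w'' (ivar ''k'') (ivar ''j'')))])]"

definition edge_expr :: iexp where
  "edge_expr = IPlus (ivar ''cnt'') (ICell ''ix'' (ivar ''i'') (ivar ''j''))"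

definition meets_expr :: "string \<Rightarrow> bexp" where
  "meets_expr a =
     BAnd (RLess (RConst 0) (RCell ''w'' (ivar ''i'') (ivar ''j'')))
       (BAnd (RLess (rvar a) (RPlus (rvar ''s'') (RConst 1)))
         (RLess (rvar ''s'') (RPlus (rvar a) (RCell ''w'' (ivar ''i'') (ivar ''j'')))))"

text \<open>The slot number is carried twice: \<open>k\<close> addresses, and \<open>s\<close> is
  the same value as a number cell, because it is compared with data and naturals cannot be
  converted.\<close>

definition adjacent_com :: com where
  "adjacent_com = CSeqs [
     CSetI ''adj'' edge_expr edge_expr (IConst 1),
     CSetI ''free'' edge_expr (IConst 0) (IConst 1),
     set_rvar ''s'' (RConst 0),
     CFor ''k'' ''n'' (CSeqs [
       CIf (meets_expr ''p'')
         (CSetI ''adj'' edge_expr (ICell ''ix'' (ivar ''i'') (ivar ''k'')) (IConst 1))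
         CSkip,
       CIf (BAnd (meets_expr ''q'') (BNot (RLess (rvar ''m'') (RPlus (rvar ''s'') (RConst 1)))))
         (CSeq (CSetI ''adj'' (ICell ''ix'' (ivar ''j'') (ivar ''k'')) edge_expr (IConst 1))
           (CSetI ''free'' (ICell ''ix'' (ivar ''j'') (ivar ''k'')) (IConst 0) (IConst 1)))
         CSkip,
       set_rvar ''s'' (RPlus (rvar ''s'') (RConst 1))])]"

definition graph_com :: com where
  "graph_com = CFor ''i'' ''n'' (CFor ''j'' ''n'' (CSeq prefix_com adjacent_com))"

definition find_free_com :: com where
  "find_free_com = CSeq (set_ivar ''go'' (IConst 0))
     (CFor ''k'' ''N''
       (CIf (ILess (IConst 0) (ICell ''free'' (ivar ''k'') (IConst 0)))
         (CSeq (set_ivar ''go'' (IConst 1)) (set_ivar ''cur'' (ivar ''k'')))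
         CSkip))"

text \<open>The initial value \<open>N\<close> of \<open>bl\<close> acts as infinity: only
  neighbours with a smaller label are accepted.\<close>

definition find_best_com :: com where
  "find_best_com = CSeq (set_ivar ''bl'' (ivar ''N''))
     (CFor ''k'' ''N''
       (CIf (BAnd (ILess (IConst 0) (ICell ''adj'' (ivar ''cur'') (ivar ''k'')))
               (ILess (ICell ''lab'' (ivar ''k'') (IConst 0)) (ivar ''bl'')))
         (CSeq (set_ivar ''bl'' (ICell ''lab'' (ivar ''k'') (IConst 0)))
           (set_ivar ''best'' (ivar ''k'')))
         CSkip))"

definition reassign_com :: com where
  "reassign_com = CSeqs [
     CIf (ILess (IConst 0) (ICell ''own'' (ivar ''best'') (IConst 0)))
       (CSetI ''free'' (IMinus (ICell ''own'' (ivar ''best'') (IConst 0)) (IConst 1)) (IConst 0) (IConst 1))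
       CSkip,
     CSetI ''free'' (ivar ''cur'') (IConst 0) (IConst 0),
     CSetI ''own'' (ivar ''best'') (IConst 0) (IPlus (ivar ''cur'') (IConst 1)),
     CSetI ''lab'' (ivar ''best'') (IConst 0) (IPlus (ivar ''bl'') (IConst 1))]"

text \<open>\<open>N\<close> labels of size at most \<open>N\<close> allow \<open>N * N\<close>
  raises, and one outer round of \<open>N + 1\<close> steps per node exceeds this. Nested loops
  replace the product, and steps after the last free node has been matched are idle.\<close>

definition auction_com :: com where
  "auction_com = CFor ''i'' ''N'' (CFor ''j'' ''N1''
     (CSeq find_free_com
       (CIf (ILess (IConst 0) (ivar ''go'')) (CSeq find_best_com reassign_com) CSkip)))"

abbreviation scaled_y :: rexp where
  "scaled_y \<equiv> RTimes (rvar ''gamma'') (RCell ''y'' (ivar ''i'') (IConst 0))"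

abbreviation small_expr :: bexp where
  "small_expr \<equiv> RLess (RCell ''x'' (ivar ''i'') (ivar ''j'')) scaled_y"

definition big_com :: com where
  "big_com = CSeq (set_rvar ''m'' (RConst 0))
     (CFor ''i'' ''n''
       (CIf small_expr
         (CSetR ''xout'' (ivar ''i'') (ivar ''j'') (RConst 0))
         (CSeq (CSetR ''xout'' (ivar ''i'') (ivar ''j'') (RCell ''x'' (ivar ''i'') (ivar ''j'')))
           (set_rvar ''m'' (RPlus (rvar ''m'') (RCell ''x'' (ivar ''i'') (ivar ''j'')))))))"

text \<open>The disjunction of two strict comparisons is the inequality test of
  \<open>selected\<close>; the machine has no equality test.\<close>

definition small_com :: com where
  "small_com =
     CFor ''i'' ''n''
       (CIf (BAnd small_expr (BAnd
               (BOr (ILess (ICell ''own'' edge_expr (IConst 0)) (IPlus edge_expr (IConst 1)))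
                 (ILess (IPlus edge_expr (IConst 1)) (ICell ''own'' edge_expr (IConst 0))))
               (BNot (RLess (RConst 1) (RPlus (rvar ''m'') scaled_y)))))
         (CSeq (CSetR ''xout'' (ivar ''i'') (ivar ''j'') scaled_y)
           (set_rvar ''m'' (RPlus (rvar ''m'') scaled_y)))
         CSkip)"

definition output_com :: com where
  "output_com = CSeq
     (CFor ''j'' ''n'' (CSeq big_com small_com))
     (CFor ''i'' ''n'' (CSetR ''yout'' (ivar ''i'') (IConst 0) (RCell ''y'' (ivar ''i'') (IConst 0))))"

definition rounding_com :: com where
  "rounding_com = CSeqs [weights_com, graph_com, auction_com, output_com]"

section \<open>Correctness of the program\<close>

text \<open>Sums of at most \<open>m\<close> generators. Every accumulator of the program is such a
  running sum, and counting its terms is what bounds its bit length.\<close>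

fun gsums :: "real set \<Rightarrow> nat \<Rightarrow> real set" where
  "gsums G 0 = {0}"
| "gsums G (Suc m) = gsums G m \<union> {r + g |r g. r \<in> gsums G m \<and> g \<in> G}"

lemma gsums_mono: "m \<le> m' \<Longrightarrow> r \<in> gsums G m \<Longrightarrow> r \<in> gsums G m'"
  by (induction rule: dec_induct) auto

lemma gsums_add: "r \<in> gsums G m \<Longrightarrow> g \<in> G \<Longrightarrow> r + g \<in> gsums G (Suc m)"
  by auto

lemma gsums_zero: "0 \<in> gsums G m"
  by (induction m) auto

lemma gsums_atom: "g \<in> G \<Longrightarrow> g \<in> gsums G (Suc m)"
  using gsums_add[OF gsums_zero, of g G m] by simp

lemma gsums_sum: "(\<And>k. k < m \<Longrightarrow> h k \<in> G) \<Longrightarrow> (\<Sum>k<m. h k) \<in> gsums G m"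
proof (induction m)
  case (Suc m)
  then show ?case using gsums_add[of "\<Sum>k<m. h k" G m "h m"] by simp
qed simp

text \<open>The longest sums are the client totals, with up to \<open>n\<close> big and
  \<open>n\<close> small values, which fit into \<open>2 * n + 2\<close> terms. The successor in the
  bounds on \<open>K\<close> and \<open>M\<close> accommodates \<open>N1\<close> and the owner
  codes.\<close>

locale rounding_run = cost_model + rounding_instance +
  fixes G :: "real set"
  assumes K_ge: "Suc (n * n + n * n) \<le> K" and M_ge: "Suc (n * n + n * n) \<le> M"
    and G_01: "0 \<in> G" "1 \<in> G"
    and G_X: "i < n \<Longrightarrow> j < n \<Longrightarrow> X i j \<in> G" and G_Y: "i < n \<Longrightarrow> \<gamma> * Y i \<in> G"
    and G_w: "i < n \<Longrightarrow> j < n \<Longrightarrow> w i j \<in> G"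
    and gsums_R: "gsums G (2 * n + 2) \<subseteq> R"
begin

definition inputs :: "state \<Rightarrow> bool" where
  "inputs s \<longleftrightarrow> imem s ''n'' 0 0 = n \<and> rmem s ''d'' = D \<and> rmem s ''x'' = X \<and>
     (\<forall>i. rmem s ''y'' i 0 = Y i) \<and> rmem s ''gamma'' 0 0 = \<gamma>"

definition cleared :: "state \<Rightarrow> bool" where
  "cleared s \<longleftrightarrow> (\<forall>v. imem s ''own'' v 0 = 0 \<and> imem s ''lab'' v 0 = 0)"

definition has_graph :: "(nat \<times> nat) set \<Rightarrow> state \<Rightarrow> bool" where
  "has_graph S s \<longleftrightarrow> (\<forall>u v. imem s ''adj'' u v = of_bool ((u, v) \<in> S))"

definition free_nodes :: "nat set \<Rightarrow> state \<Rightarrow> bool" where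
  "free_nodes U s \<longleftrightarrow> (\<forall>u. imem s ''free'' u 0 = of_bool (u \<in> U))"

definition coded :: "state \<Rightarrow> bool" where
  "coded s \<longleftrightarrow> imem s ''cnt'' 0 0 = n * n \<and> imem s ''N'' 0 0 = n * n + n * n \<and>
     imem s ''N1'' 0 0 = Suc (n * n + n * n) \<and>
     (\<forall>i<n. \<forall>j<n. imem s ''ix'' i j = i * n + j \<and> rmem s ''w'' i j = w i j)"

lemma n_le: "n \<le> n * n + n * n"
  by (cases n) auto

lemma n_bounds: "n \<le> M" "n \<le> K" "Suc 0 \<le> K"
  using n_le K_ge M_ge by linarith+

lemma R_01: "0 \<in> R" "1 \<in> R"
  using zero_one_in_R .

lemma in_R: "r \<in> gsums G m \<Longrightarrow> m \<le> 2 * n + 2 \<Longrightarrow> r \<in> R"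
  using gsums_R gsums_mono by blast

lemma G_R: "g \<in> G \<Longrightarrow> g \<in> R"
  using in_R[OF gsums_atom[of g G 0]] by simp

lemma w_small: "0 < X i j \<Longrightarrow> X i j < \<gamma> * Y i \<Longrightarrow> w i j = X i j / (\<gamma> * Y i)"
  by (simp add: w_def)

lemma weights_correct:
  assumes "inputs s" "cleared s" "has_graph {} s" "free_nodes {} s"
  shows "wp weights_com (\<lambda>s'. inputs s' \<and> cleared s' \<and> has_graph {} s' \<and> free_nodes {} s' \<and> coded s') s"
proof -
  \<comment> \<open>The pairs lexicographically below \<open>(i, j)\<close> are done, and their
    number is the value of the counter.\<close>
  define C where "C i j s \<longleftrightarrow> inputs s \<and> cleared s \<and> has_graph {} s \<and> free_nodes {} s \<and>
    imem s ''cnt'' 0 0 = i * n + j \<and>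
    (\<forall>i'<n. \<forall>j'<n. i' < i \<or> i' = i \<and> j' < j \<longrightarrow>
       imem s ''ix'' i' j' = i' * n + j' \<and> rmem s ''w'' i' j' = w i' j')" for i j s
  note defs = C_def inputs_def cleared_def has_graph_def free_nodes_def
  show ?thesis
    unfolding weights_com_def CSeqs.simps
    apply (rule wp_CSeq, rule wp_CSetI, simp, simp, simp, rule wp_CSeq)
    apply (rule wp_CFor[where m = n and I = "\<lambda>i s. C i 0 s"])
          apply (use n_bounds assms in \<open>simp_all add: defs\<close>)[6]
    subgoal for i s
      apply (rule wp_CFor[where m = n and I = "\<lambda>j s. imem s ''i'' 0 0 = i \<and> C i j s"])
            apply (use n_bounds in \<open>simp_all add: defs\<close>)[6]
      subgoal for j s
        using node_less[of i j] K_ge G_R[OF G_Y[of i]] G_R[OF G_w[of i j]]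
        apply (intro wp_CSeq wp_CSetI wp_CIf wp_CSetR)
                            apply (auto simp: defs R_01 w_small w_def less_Suc_eq)
        done
      subgoal by (simp add: defs less_Suc_eq)
      done
    subgoal for s
      using K_ge by (intro wp_CSeq wp_CSetI) (auto simp: defs coded_def)
    done
qed


lemma set_other_icell [simp]:
  "a \<noteq> ''n'' \<Longrightarrow> inputs (set_icell a i j v s) = inputs s"
  "a \<notin> {''own'', ''lab''} \<Longrightarrow> cleared (set_icell a i j v s) = cleared s"
  "a \<noteq> ''adj'' \<Longrightarrow> has_graph S (set_icell a i j v s) = has_graph S s"
  "a \<noteq> ''free'' \<Longrightarrow> free_nodes U (set_icell a i j v s) = free_nodes U s"
  "a \<notin> {''cnt'', ''N'', ''N1'', ''ix''} \<Longrightarrow> coded (set_icell a i j v s) = coded s"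
  by (auto simp: inputs_def cleared_def has_graph_def free_nodes_def coded_def)

lemma set_other_rcell [simp]:
  "a \<notin> {''d'', ''x'', ''y'', ''gamma''} \<Longrightarrow> inputs (set_rcell a i j r s) = inputs s"
  "cleared (set_rcell a i j r s) = cleared s"
  "has_graph S (set_rcell a i j r s) = has_graph S s"
  "free_nodes U (set_rcell a i j r s) = free_nodes U s"
  "a \<noteq> ''w'' \<Longrightarrow> coded (set_rcell a i j r s) = coded s"
  by (auto simp: inputs_def cleared_def has_graph_def free_nodes_def coded_def)

lemma read_inputs [simp]:
  assumes "inputs s"
  shows "imem s ''n'' 0 0 = n" "rmem s ''d'' i j = D i j" "rmem s ''x'' i j = X i j"
    "rmem s ''y'' i 0 = Y i" "rmem s ''gamma'' 0 0 = \<gamma>"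
  using assms by (auto simp: inputs_def)

lemma read_coded [simp]:
  assumes "coded s"
  shows "imem s ''cnt'' 0 0 = n * n" "imem s ''N'' 0 0 = n * n + n * n"
    "imem s ''N1'' 0 0 = Suc (n * n + n * n)"
    "i < n \<Longrightarrow> j < n \<Longrightarrow> imem s ''ix'' i j = i * n + j"
    "i < n \<Longrightarrow> j < n \<Longrightarrow> rmem s ''w'' i j = w i j"
  using assms by (auto simp: coded_def)

section \<open>Construction of the bipartite graph in memory\<close>

definition at_pair :: "nat \<Rightarrow> nat \<Rightarrow> (nat \<times> nat) set \<Rightarrow> state \<Rightarrow> bool" where
  "at_pair i j S s \<longleftrightarrow> inputs s \<and> cleared s \<and> coded s \<and> has_graph S s \<and> free_nodes (Domain S) s \<and>
     imem s ''i'' 0 0 = i \<and> imem s ''j'' 0 0 = j"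

text \<open>The array \<open>free\<close> mirrors the left nodes inserted so far, since the auction
  starts with all of them unmatched. An edge to a facility slot leaves a pair node, already listed
  through its self-edge, so \<open>free\<close> stays as it is.\<close>

lemma at_pair_insert:
  "at_pair i j S s \<Longrightarrow> u \<in> Domain S \<Longrightarrow>
     at_pair i j (insert (u, v) S) (set_icell ''adj'' u v (Suc 0) s)"
  unfolding at_pair_def by (simp add: insert_absorb) (simp add: has_graph_def)

lemma at_pair_insert_free:
  "at_pair i j S s \<Longrightarrow>
     at_pair i j (insert (u, v) S) (set_icell ''free'' u 0 (Suc 0) (set_icell ''adj'' u v (Suc 0) s))"
  unfolding at_pair_def by simp (simp add: has_graph_def free_nodes_def)

lemma prefix_correct:
  assumes "i < n" "j < n" "at_pair i j S s"
  shows "wp prefix_com (\<lambda>s'. at_pair i j S s' \<and>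
    rmem s' ''p'' 0 0 = prefix_mass n (D i) (w i) j \<and>
    rmem s' ''q'' 0 0 = prefix_mass n Y (\<lambda>i. w i j) i \<and>
    rmem s' ''m'' 0 0 = client_mass j) s"
proof -
  define C where "C k s \<longleftrightarrow> at_pair i j S s \<and>
    rmem s ''p'' 0 0 = (\<Sum>k'<k. if before (D i) k' j then w i k' else 0) \<and>
    rmem s ''q'' 0 0 = (\<Sum>k'<k. if before Y k' i then w k' j else 0) \<and>
    rmem s ''m'' 0 0 = (\<Sum>k'<k. w k' j)" for k s
  have R: "(\<Sum>k'<k. if before (D i) k' j then w i k' else 0) + w i k \<in> R"
    "(\<Sum>k'<k. if before Y k' i then w k' j else 0) + w k j \<in> R"
    "(\<Sum>k'<k. w k' j) + w k j \<in> R" if "k < n" for k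
    using that assms(1,2) G_01 by (auto intro!: in_R[of _ "Suc k"] gsums_add gsums_sum G_w simp del: gsums.simps)
  show ?thesis
    unfolding prefix_com_def CSeqs.simps
    apply (intro wp_CSeq wp_CSetR; simp add: R_01)
    apply (rule wp_CFor[where m = n and I = C])
          apply (use n_bounds assms in \<open>simp_all add: C_def at_pair_def\<close>)[6]
    subgoal for k s
      using R[of k] assms
      by (intro wp_CSeq wp_CSetR wp_CIf wp_CSkip) (simp_all add: C_def at_pair_def before_def, auto)
    subgoal by (simp add: C_def prefix_mass_def client_mass_def)
    done
qed

lemma adjacent_0 [simp]: "adjacent 0 i j = {}"
  by (simp add: adjacent_def)

lemma adjacent_Suc:
  "adjacent (Suc m) i j = adjacent m i j \<union>
     (if meets_slot i j m then {(enode i j, i * n + m)} else {}) \<union>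
     (if meets_unit i j m \<and> real m + 1 \<le> client_mass j then {(j * n + m, enode i j)} else {})"
  unfolding adjacent_def by (auto simp: less_Suc_eq)

lemma adjacent_correct:
  assumes ij: "i < n" "j < n" and "at_pair i j S s"
    and "rmem s ''p'' 0 0 = prefix_mass n (D i) (w i) j"
    and "rmem s ''q'' 0 0 = prefix_mass n Y (\<lambda>i. w i j) i"
    and "rmem s ''m'' 0 0 = client_mass j"
  shows "wp adjacent_com (at_pair i j (S \<union> insert (enode i j, enode i j) (adjacent n i j))) s"
proof -
  define S' where "S' k = S \<union> insert (enode i j, enode i j) (adjacent k i j)" for k
  define C where "C k S s \<longleftrightarrow> at_pair i j S s \<and>
    rmem s ''p'' 0 0 = prefix_mass n (D i) (w i) j \<and>
    rmem s ''q'' 0 0 = prefix_mass n Y (\<lambda>i. w i j) i \<and>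
    rmem s ''m'' 0 0 = client_mass j \<and> rmem s ''s'' 0 0 = real k" for k S s
  have "prefix_mass n (D i) (w i) j \<in> gsums G n" "prefix_mass n Y (\<lambda>i. w i j) i \<in> gsums G n"
    unfolding prefix_mass_def using ij G_01 G_w by (auto intro!: gsums_sum)
  then have R: "prefix_mass n (D i) (w i) j + w i j \<in> R"
    "prefix_mass n Y (\<lambda>i. w i j) i + w i j \<in> R"
    using ij G_w by (auto intro!: in_R[of _ "Suc n"] gsums_add simp del: gsums.simps)
  have real_R: "real k + 1 \<in> R" if "k < n" for k
  proof -
    \<comment> \<open>The slot counter held as a number is itself a sum of generators
      \<open>1\<close>.\<close>
    have "(\<Sum>k'<Suc k. 1) \<in> gsums G (Suc k)" using G_01 by (intro gsums_sum)
    then show ?thesis using that in_R[of "real k + 1" "Suc k"] by (simp add: add.commute del: gsums.simps)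
  qed
  have e: "n * n + (i * n + j) = enode i j" "enode i j \<le> K"
    using enode_less[OF ij] K_ge by (auto simp: enode_def)
  have S'_Suc: "S' (Suc k) =
      (if meets_unit i j k \<and> real k + 1 \<le> client_mass j then insert (j * n + k, enode i j) else id)
        ((if meets_slot i j k then insert (enode i j, i * n + k) else id) (S' k))" for k
    unfolding S'_def adjacent_Suc by auto
  have slot: "wp (CIf (meets_expr ''p'')
         (CSetI ''adj'' edge_expr (ICell ''ix'' (ivar ''i'') (ivar ''k'')) (IConst 1)) CSkip)
       (\<lambda>s'. imem s' ''k'' 0 0 = k \<and>
         C k ((if meets_slot i j k then insert (enode i j, i * n + k) else id) (S' k)) s') s"
    if "k < n" "imem s ''k'' 0 0 = k" "C k (S' k) s" for k s
  proof -
    have "at_pair i j (insert (enode i j, i * n + k) (S' k))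
        (set_icell ''adj'' (enode i j) (i * n + k) (Suc 0) s)"
      using that(3) by (intro at_pair_insert) (auto simp: C_def S'_def)
    moreover have "inputs s" "coded s" "imem s ''i'' 0 0 = i" "imem s ''j'' 0 0 = j"
      using that(3) by (simp_all add: C_def at_pair_def)
    ultimately show ?thesis
      using that ij R(1) real_R[OF that(1)] unfolding meets_expr_def edge_expr_def
      by (intro wp_CIf wp_CSetI wp_CSkip)
         (simp_all add: C_def e R_01 n_bounds meets_def, argo)
  qed
  have unit: "wp (CIf (BAnd (meets_expr ''q'') (BNot (RLess (rvar ''m'') (RPlus (rvar ''s'') (RConst 1)))))
         (CSeq (CSetI ''adj'' (ICell ''ix'' (ivar ''j'') (ivar ''k'')) edge_expr (IConst 1))
           (CSetI ''free'' (ICell ''ix'' (ivar ''j'') (ivar ''k'')) (IConst 0) (IConst 1))) CSkip)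
       (\<lambda>s'. imem s' ''k'' 0 0 = k \<and> C k ((if meets_unit i j k \<and> real k + 1 \<le> client_mass j
           then insert (j * n + k, enode i j) else id) S1) s') s"
    if "k < n" "imem s ''k'' 0 0 = k" "C k S1 s" for k s S1
  proof -
    have "at_pair i j (insert (j * n + k, enode i j) S1)
        (set_icell ''free'' (j * n + k) 0 (Suc 0) (set_icell ''adj'' (j * n + k) (enode i j) (Suc 0) s))"
      using that(3) by (intro at_pair_insert_free) (simp add: C_def)
    moreover have "inputs s" "coded s" "imem s ''i'' 0 0 = i" "imem s ''j'' 0 0 = j"
      using that(3) by (simp_all add: C_def at_pair_def)
    ultimately show ?thesis
      using that ij R(2) real_R[OF that(1)] unfolding meets_expr_def edge_expr_def
      by (intro wp_CIf wp_CSeq wp_CSetI wp_CSkip)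
         (simp_all add: C_def e R_01 n_bounds meets_def not_less, argo)
  qed
  have at_s [simp]: "at_pair i j S2 (set_rcell ''s'' 0 0 r s) = at_pair i j S2 s" for S2 r s
    by (simp add: at_pair_def)
  have at_k [simp]: "at_pair i j S2 (set_icell ''k'' 0 0 r s) = at_pair i j S2 s" for S2 r s
    by (simp add: at_pair_def)
  have init: "at_pair i j (insert (enode i j, enode i j) S) (set_icell ''free'' (enode i j) 0 (Suc 0)
      (set_icell ''adj'' (enode i j) (enode i j) (Suc 0) s))"
    using assms(3) by (rule at_pair_insert_free)
  have at: "inputs s" "coded s" "imem s ''i'' 0 0 = i" "imem s ''j'' 0 0 = j"
    using assms(3) by (simp_all add: at_pair_def)
  show ?thesis
    unfolding adjacent_com_def CSeqs.simps
    apply (intro wp_CSeq wp_CSetI wp_CSetR)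
            apply (use assms at in \<open>simp_all add: edge_expr_def e R_01 n_bounds\<close>)[9]
    apply (rule wp_CFor[where m = n and I = "\<lambda>k. C k (S' k)"])
          apply (use n_bounds assms init at in \<open>simp_all add: C_def S'_def edge_expr_def e\<close>)[6]
    subgoal for k s
      apply (rule wp_CSeq, rule wp_mono[OF slot], assumption+)
      apply (rule wp_CSeq, rule wp_mono[OF unit], assumption, blast, blast)
      apply (rule wp_CSetR)
         apply (use real_R[of k] in \<open>simp_all add: C_def at_pair_def R_01 n_bounds\<close>)[3]
      apply (simp add: S'_Suc)
      apply (auto simp: C_def at_pair_def)
      done
    subgoal by (simp add: C_def S'_def)
    done
qed

definition processed :: "nat \<Rightarrow> nat \<Rightarrow> (nat \<times> nat) set" where
  "processed i j = (\<Union>i'<i. \<Union>j'<n. insert (enode i' j', enode i' j') (adjacent n i' j')) \<union>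
     (\<Union>j'<j. insert (enode i j', enode i j') (adjacent n i j'))"

lemma processed_simps:
  "processed 0 0 = {}" "processed i n = processed (Suc i) 0" "processed n 0 = graph"
  "processed i (Suc j) = processed i j \<union> insert (enode i j, enode i j) (adjacent n i j)"
  by (auto simp: processed_def graph_def lessThan_Suc)

lemma graph_correct:
  assumes "inputs s" "cleared s" "has_graph {} s" "free_nodes {} s" "coded s"
  shows "wp graph_com (\<lambda>s'. inputs s' \<and> cleared s' \<and> has_graph graph s' \<and>
    free_nodes (Domain graph) s' \<and> coded s') s"
proof -
  define C where "C S s \<longleftrightarrow> inputs s \<and> cleared s \<and> coded s \<and> has_graph S s \<and>
    free_nodes (Domain S) s" for S s
  show ?thesis
    unfolding graph_com_def
    apply (rule wp_CFor[where m = n and I = "\<lambda>i. C (processed i 0)"])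
          apply (use n_bounds assms in \<open>simp_all add: C_def processed_simps(1)\<close>)[6]
    subgoal for i s
      apply (rule wp_CFor[where m = n and I = "\<lambda>j s. imem s ''i'' 0 0 = i \<and> C (processed i j) s"])
            apply (use n_bounds in \<open>simp_all add: C_def\<close>)[6]
      subgoal for j s
        apply (rule wp_CSeq, rule wp_mono[OF prefix_correct[of i j "processed i j"]])
           apply (simp_all add: C_def at_pair_def)[3]
        apply (rule wp_mono[OF adjacent_correct[of i j "processed i j"]])
              apply (auto simp: C_def at_pair_def processed_simps)
        done
      subgoal by (simp add: C_def processed_simps)
      done
    subgoal by (simp add: C_def processed_simps)
    done
qed

end

section \<open>Execution of the auction\<close>

context rounding_run
begin

abbreviation "nodes \<equiv> n * n + n * n"

lemma nodes_bounds: "nodes \<le> M" "nodes \<le> K" "Suc nodes \<le> M" "Suc nodes \<le> K" "Suc 0 \<le> K"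
  using K_ge M_ge by linarith+

definition at_auction :: "nat set \<Rightarrow> (nat \<Rightarrow> nat) \<Rightarrow> (nat \<Rightarrow> nat) \<Rightarrow> state \<Rightarrow> bool" where
  "at_auction U own lab s \<longleftrightarrow> inputs s \<and> coded s \<and> has_graph graph s \<and> free_nodes U s \<and>
     (\<forall>v. imem s ''own'' v 0 = own v) \<and> (\<forall>v. imem s ''lab'' v 0 = lab v) \<and>
     auction_inv graph nodes U own lab"

lemma at_auction_icell [simp]:
  "a \<notin> {''n'', ''cnt'', ''N'', ''N1'', ''ix'', ''adj'', ''free'', ''own'', ''lab''} \<Longrightarrow>
     at_auction U own lab (set_icell a i j r s) = at_auction U own lab s"
  by (auto simp: at_auction_def)

lemma at_auctionD:
  assumes "at_auction U own lab s"
  shows "imem s ''N'' 0 0 = nodes" "imem s ''N1'' 0 0 = Suc nodes"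
    "imem s ''free'' u 0 = of_bool (u \<in> U)" "imem s ''adj'' u v = of_bool ((u, v) \<in> graph)"
    "imem s ''own'' v 0 = own v" "imem s ''lab'' v 0 = lab v"
  using assms by (auto simp: at_auction_def free_nodes_def has_graph_def)

lemma at_auction_inv: "at_auction U own lab s \<Longrightarrow> auction_inv graph nodes U own lab"
  by (simp add: at_auction_def)

lemma at_auction_free: "at_auction U own lab s \<Longrightarrow> U \<subseteq> Domain graph"
  and at_auction_lab_le: "at_auction U own lab s \<Longrightarrow> lab v \<le> nodes"
  by (rule auction_inv_free auction_inv_lab, erule at_auction_inv)+

lemma find_free_correct:
  assumes "at_auction U own lab s" "imem s ''i'' 0 0 = i" "imem s ''j'' 0 0 = j"
  shows "wp find_free_com (\<lambda>s'. at_auction U own lab s' \<and> imem s' ''i'' 0 0 = i \<and>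
    imem s' ''j'' 0 0 = j \<and>
    (if U = {} then imem s' ''go'' 0 0 = 0
     else imem s' ''go'' 0 0 = 1 \<and> imem s' ''cur'' 0 0 \<in> U)) s"
proof -
  define C where "C k s \<longleftrightarrow> at_auction U own lab s \<and> imem s ''i'' 0 0 = i \<and> imem s ''j'' 0 0 = j \<and>
    (if U \<inter> {..<k} = {} then imem s ''go'' 0 0 = 0
     else imem s ''go'' 0 0 = 1 \<and> imem s ''cur'' 0 0 \<in> U)" for k s
  have "U \<subseteq> {..<nodes}"
    using at_auction_free[OF assms(1)] graph_bounds by blast
  then have U: "U \<inter> {..<nodes} = U" by blast
  have body: "wp (CIf (ILess (IConst 0) (ICell ''free'' (ivar ''k'') (IConst 0)))
         (CSeq (set_ivar ''go'' (IConst 1)) (set_ivar ''cur'' (ivar ''k''))) CSkip)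
       (\<lambda>s'. imem s' ''k'' 0 0 = k \<and> imem s' ''N'' 0 0 = nodes \<and>
          C (Suc k) (set_icell ''k'' 0 0 (Suc k) s')) s"
    if "C k s" "imem s ''k'' 0 0 = k" for k s
  proof -
    have at: "at_auction U own lab s" using that by (simp add: C_def)
    have "U \<inter> {..<Suc k} = (if k \<in> U then insert k (U \<inter> {..<k}) else U \<inter> {..<k})"
      by (auto simp: lessThan_Suc)
    then show ?thesis
      using that at_auctionD[OF at] nodes_bounds
      by (intro wp_CIf wp_CSeq wp_CSetI wp_CSkip) (simp_all add: C_def split: if_splits)
  qed
  show ?thesis
    unfolding find_free_com_def
    apply (rule wp_CSeq, rule wp_CSetI, simp, simp, simp)
    apply (rule wp_CFor[where m = nodes and I = C])
          apply (use nodes_bounds assms at_auctionD[OF assms(1)] in \<open>simp_all add: C_def\<close>)[6]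
    subgoal for k s by (rule body)
    subgoal using U by (simp add: C_def)
    done
qed

lemma find_best_correct:
  assumes "at_auction U own lab s" "imem s ''i'' 0 0 = i" "imem s ''j'' 0 0 = j"
    and u: "imem s ''cur'' 0 0 = u" "u \<in> U"
  shows "wp find_best_com (\<lambda>s'. at_auction U own lab s' \<and> imem s' ''i'' 0 0 = i \<and>
    imem s' ''j'' 0 0 = j \<and> imem s' ''cur'' 0 0 = u \<and>
    (\<exists>v. imem s' ''best'' 0 0 = v \<and> imem s' ''bl'' 0 0 = lab v \<and> lab v < nodes \<and>
       (u, v) \<in> graph \<and> (\<forall>v'. (u, v') \<in> graph \<longrightarrow> lab v \<le> lab v'))) s"
proof -
  \<comment> \<open>\<open>best\<close> has a meaning only once \<open>bl\<close> has dropped below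
    its initial value, hence the implication in the last conjunct.\<close>
  define C where "C k s \<longleftrightarrow> at_auction U own lab s \<and> imem s ''i'' 0 0 = i \<and> imem s ''j'' 0 0 = j \<and>
    imem s ''cur'' 0 0 = u \<and> imem s ''bl'' 0 0 \<le> nodes \<and>
    (\<forall>v'<k. (u, v') \<in> graph \<longrightarrow> imem s ''bl'' 0 0 \<le> lab v') \<and>
    (imem s ''bl'' 0 0 < nodes \<longrightarrow> (u, imem s ''best'' 0 0) \<in> graph \<and>
       imem s ''bl'' 0 0 = lab (imem s ''best'' 0 0))" for k s
  have body: "wp (CIf (BAnd (ILess (IConst 0) (ICell ''adj'' (ivar ''cur'') (ivar ''k'')))
               (ILess (ICell ''lab'' (ivar ''k'') (IConst 0)) (ivar ''bl'')))
         (CSeq (set_ivar ''bl'' (ICell ''lab'' (ivar ''k'') (IConst 0)))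
           (set_ivar ''best'' (ivar ''k'')))
         CSkip)
       (\<lambda>s'. imem s' ''k'' 0 0 = k \<and> imem s' ''N'' 0 0 = nodes \<and>
          C (Suc k) (set_icell ''k'' 0 0 (Suc k) s')) s"
    if "C k s" "imem s ''k'' 0 0 = k" for k s
  proof -
    have at: "at_auction U own lab s" using that by (simp add: C_def)
    show ?thesis
      using that at_auctionD[OF at] nodes_bounds
      by (intro wp_CIf wp_CSeq wp_CSetI wp_CSkip)
        (simp_all add: C_def less_Suc_eq, (meson less_imp_le_nat order_trans not_less)+)
  qed
  obtain v where v: "(u, v) \<in> graph" "lab v < nodes"
    using auction_progress[OF at_auction_inv[OF assms(1)] u(2)] by blast
  have le: "v' < nodes" if "(u, v') \<in> graph" for v' using that graph_bounds by blast
  show ?thesis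
    unfolding find_best_com_def
    apply (rule wp_CSeq, rule wp_CSetI, simp, simp, simp)
    apply (rule wp_CFor[where m = nodes and I = C])
          apply (use nodes_bounds assms at_auctionD[OF assms(1)] in \<open>simp_all add: C_def\<close>)[6]
    subgoal for k s by (rule body)
    subgoal for s
    proof -
      assume C: "C nodes s"
      \<comment> \<open>The neighbour \<open>v\<close> supplied by the fractional matching
        guarantees that the initial value of \<open>bl\<close> was replaced.\<close>
      have "imem s ''bl'' 0 0 \<le> lab v" using C v le unfolding C_def by blast
      with v(2) have "imem s ''bl'' 0 0 < nodes" by simp
      with C le show ?thesis unfolding C_def by auto
    qed
    done
qed

lemma reassign_correct:
  assumes at: "at_auction U own lab s" and ij: "imem s ''i'' 0 0 = i" "imem s ''j'' 0 0 = j"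
    and u: "imem s ''cur'' 0 0 = u" "u \<in> U"
    and v: "imem s ''best'' 0 0 = v" "imem s ''bl'' 0 0 = lab v" "lab v < nodes" "(u, v) \<in> graph"
    and min: "\<And>v'. (u, v') \<in> graph \<Longrightarrow> lab v \<le> lab v'"
  shows "wp reassign_com (\<lambda>s'. imem s' ''i'' 0 0 = i \<and> imem s' ''j'' 0 0 = j \<and>
    at_auction ((U \<union> {u'. own v = Suc u'}) - {u}) (own(v := Suc u)) (lab(v := Suc (lab v))) s') s"
proof -
  let ?U = "(U \<union> {u'. own v = Suc u'}) - {u}"
  have inv: "auction_inv graph nodes ?U (own(v := Suc u)) (lab(v := Suc (lab v)))"
    by (rule auction_inv_step[OF at_auction_inv[OF at] u(2) v(4) min v(3)]) auto
  have "u < nodes" using v(4) graph_bounds by blast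
  then have K: "Suc u \<le> K" "Suc (lab v) \<le> K" using v(3) nodes_bounds by linarith+
  have s: "inputs s" "coded s" "has_graph graph s" "free_nodes U s"
    using at by (simp_all add: at_auction_def)
  show ?thesis
    unfolding reassign_com_def CSeqs.simps
    using at_auctionD[OF at] ij u v nodes_bounds K s inv
    by (intro wp_CIf wp_CSeq wp_CSetI wp_CSkip)
      (simp_all add: at_auction_def, auto simp: free_nodes_def)
qed

text \<open>Each step raises one label, and no label exceeds the number of nodes.\<close>

lemma auction_correct:
  assumes "inputs s" "cleared s" "has_graph graph s" "free_nodes (Domain graph) s" "coded s"
  shows "wp auction_com (\<lambda>s'. \<exists>own lab. at_auction {} own lab s') s"
proof -
  \<comment> \<open>\<open>c\<close> counts the steps made: unless the auction has finished, each of
    them raised the sum of the labels by one.\<close>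
  define C where "C c s \<longleftrightarrow> (\<exists>U own lab. at_auction U own lab s \<and>
    (U = {} \<or> c \<le> (\<Sum>v<nodes. lab v)))" for c s
  have start: "C 0 s"
    using assms unfolding C_def at_auction_def cleared_def
    by (intro exI[of _ "Domain graph"] exI[of _ "\<lambda>_. 0"]) (auto simp: auction_inv_def)
  have step: "wp (CSeq find_free_com
       (CIf (ILess (IConst 0) (ivar ''go'')) (CSeq find_best_com reassign_com) CSkip))
       (\<lambda>s'. C (Suc c) s' \<and> imem s' ''i'' 0 0 = i \<and> imem s' ''j'' 0 0 = j) s"
    if C: "C c s" and ij: "imem s ''i'' 0 0 = i" "imem s ''j'' 0 0 = j" for c i j s
  proof -
    obtain U own lab where at: "at_auction U own lab s" and le: "U = {} \<or> c \<le> (\<Sum>v<nodes. lab v)"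
      using C unfolding C_def by blast
    show ?thesis
    proof (rule wp_CSeq, rule wp_mono[OF find_free_correct[OF at ij]], rule wp_CIf, goal_cases)
      case 1 then show ?case by simp
    next
      case (2 s1)
      then have U: "U \<noteq> {}" and s1: "at_auction U own lab s1" "imem s1 ''i'' 0 0 = i"
        "imem s1 ''j'' 0 0 = j" "imem s1 ''cur'' 0 0 \<in> U"
        by (auto split: if_splits)
      show ?case
      proof (rule wp_CSeq, rule wp_mono[OF find_best_correct[OF s1(1-3) refl s1(4)]], elim conjE exE)
        fix s2 v assume s2: "at_auction U own lab s2" "imem s2 ''i'' 0 0 = i" "imem s2 ''j'' 0 0 = j"
          "imem s2 ''cur'' 0 0 = imem s1 ''cur'' 0 0" "imem s2 ''best'' 0 0 = v"
          "imem s2 ''bl'' 0 0 = lab v" "lab v < nodes" "(imem s1 ''cur'' 0 0, v) \<in> graph"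
          "\<forall>v'. (imem s1 ''cur'' 0 0, v') \<in> graph \<longrightarrow> lab v \<le> lab v'"
        have "v < nodes" using s2(8) graph_bounds by blast
        then have "(\<Sum>v'<nodes. (lab(v := Suc (lab v))) v') = Suc (\<Sum>v'<nodes. lab v')"
          by (simp add: sum.remove[of _ v])
        then have "Suc c \<le> (\<Sum>v'<nodes. (lab(v := Suc (lab v))) v')" using U le by simp
        then show "wp reassign_com (\<lambda>s'. C (Suc c) s' \<and> imem s' ''i'' 0 0 = i \<and> imem s' ''j'' 0 0 = j) s2"
          using s2(9) unfolding C_def
          by (intro wp_mono[OF reassign_correct[OF s2(1-4) s1(4) s2(5-8)]]) blast+
      qed
    next
      case (3 s1)
      then show ?case unfolding C_def by (intro wp_CSkip) (auto split: if_splits)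
    qed
  qed
  have C_set [simp]: "C c (set_icell a 0 0 r s) = C c s" if "a \<in> {''i'', ''j''}" for c a r s
    using that unfolding C_def by (elim insertE emptyE) simp_all
  have C_N: "imem s ''N'' 0 0 = nodes \<and> imem s ''N1'' 0 0 = Suc nodes" if "C c s" for c s
    using that at_auctionD unfolding C_def by blast
  show ?thesis
    unfolding auction_com_def
  proof (rule wp_CFor[where m = nodes and I = "\<lambda>i. C (i * Suc nodes)"], goal_cases)
    case (7 i s)
    show ?case
    proof (rule wp_CFor[where m = "Suc nodes" and
          I = "\<lambda>j s. imem s ''i'' 0 0 = i \<and> C (i * Suc nodes + j) s"], goal_cases)
      case (7 j s)
      then show ?case
        by (intro wp_mono[OF step[of "i * Suc nodes + j" s i j]]) (use C_N in auto)
    next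
      case (8 s)
      have "i * Suc nodes + Suc nodes = Suc i * Suc nodes" by simp
      with 8 have "C (Suc i * Suc nodes) s" "imem s ''i'' 0 0 = i" by metis+
      then show ?case using C_N[of "Suc i * Suc nodes" s] by (simp del: mult_Suc)
    qed (use 7 nodes_bounds C_N[of _ s] in simp_all)
  next
    case (8 s)
    then obtain U own lab where at: "at_auction U own lab s"
      and le: "U = {} \<or> nodes * Suc nodes \<le> (\<Sum>v<nodes. lab v)"
      unfolding C_def by blast
    \<comment> \<open>An unfinished auction would have label sum at least
      \<open>nodes * Suc nodes\<close>, yet it is at most \<open>nodes * nodes\<close>. This leaves
      only \<open>nodes = 0\<close>, where there is nothing to match.\<close>
    have "U = {}"
    proof (rule ccontr)
      assume "U \<noteq> {}"
      then have "nodes * Suc nodes \<le> (\<Sum>v<nodes. lab v)" using le by blast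
      also have "\<dots> \<le> (\<Sum>v<nodes. nodes)"
        by (intro sum_mono at_auction_lab_le[OF at])
      finally have "nodes + nodes * nodes \<le> nodes * nodes" by simp
      then have "nodes = 0" by linarith
      then have "graph = {}" using graph_bounds by simp
      then show False using at_auction_free[OF at] \<open>U \<noteq> {}\<close> by simp
    qed
    then show ?case using at by blast
  qed (use start nodes_bounds C_N[of 0 s] in simp_all)
qed

end

text \<open>Stated without reference to a matching, which becomes known only when the auction has
  run; the correctness proof then interprets the locale of a matched instance for the arrays found
  in memory.\<close>

definition (in rounding_instance) good_rounding :: "(nat \<Rightarrow> nat \<Rightarrow> real) \<Rightarrow> bool" where
  "good_rounding x' \<longleftrightarrow>
     (\<forall>i<n. \<forall>j<n. 0 \<le> x' i j \<and> (X i j = 0 \<longrightarrow> x' i j = 0) \<and> x' i j \<le> Y i \<and>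
        (0 < x' i j \<longrightarrow> \<gamma> * Y i \<le> x' i j)) \<and>
     (\<forall>j<n. (\<Sum>i<n. x' i j) \<le> 1 \<and> (\<Sum>i<n. X i j) - \<gamma> \<le> (\<Sum>i<n. x' i j)) \<and>
     (\<forall>i<n. (\<Sum>j<n. D i j * x' i j) \<le> (\<Sum>j<n. D i j * X i j) + \<gamma> * T * Y i)"

lemma (in matched_instance) good_rounding_rounded: "good_rounding rounded"
  unfolding good_rounding_def
  by (intro conjI allI impI rounded_nonneg rounded_zero rounded_le rounded_ge sum_rounded_ge
      rounded_load) (simp_all add: sum_rounded total_le_1)

section \<open>From the matching in memory to the output arrays\<close>

locale matched_run = rounding_run + matched_instance
begin

definition solved :: "state \<Rightarrow> bool" where
  "solved s \<longleftrightarrow> inputs s \<and> coded s \<and> (\<forall>v. imem s ''own'' v 0 = own v)"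

lemma solved_icell [simp]:
  "a \<notin> {''n'', ''cnt'', ''N'', ''N1'', ''ix'', ''own''} \<Longrightarrow>
     solved (set_icell a i j r s) = solved s"
  by (auto simp: solved_def)

lemma solved_rcell [simp]:
  "a \<notin> {''d'', ''x'', ''y'', ''gamma'', ''w''} \<Longrightarrow> solved (set_rcell a i j q s) = solved s"
  by (auto simp: solved_def)

lemma solved_inputs [simp]: "solved s \<Longrightarrow> inputs s" "solved s \<Longrightarrow> coded s"
  and solved_own [simp]: "solved s \<Longrightarrow> imem s ''own'' v 0 = own v"
  by (auto simp: solved_def)

lemma big_correct:
  assumes j: "j < n" and s: "solved s" "imem s ''j'' 0 0 = j"
    and out: "\<And>i j'. i < n \<Longrightarrow> j' < j \<Longrightarrow> rmem s ''xout'' i j' = rounded i j'"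
  shows "wp big_com (\<lambda>s'. solved s' \<and> imem s' ''j'' 0 0 = j \<and>
    (\<forall>i<n. \<forall>j'<j. rmem s' ''xout'' i j' = rounded i j') \<and>
    (\<forall>i<n. rmem s' ''xout'' i j = (if big i j then X i j else 0)) \<and>
    rmem s' ''m'' 0 0 = total j 0) s"
proof -
  define C where "C i s \<longleftrightarrow> solved s \<and> imem s ''j'' 0 0 = j \<and>
    (\<forall>i<n. \<forall>j'<j. rmem s ''xout'' i j' = rounded i j') \<and>
    (\<forall>i'<i. rmem s ''xout'' i' j = (if big i' j then X i' j else 0)) \<and>
    rmem s ''m'' 0 0 = (\<Sum>i'<i. if big i' j then X i' j else 0)" for i s
  have R: "(\<Sum>i'<i. if big i' j then X i' j else 0) + X i j \<in> R" if "i < n" for i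
    using that j G_01 by (auto intro!: in_R[of _ "Suc i"] gsums_add gsums_sum G_X simp del: gsums.simps)
  have body: "wp (CIf small_expr
         (CSetR ''xout'' (ivar ''i'') (ivar ''j'') (RConst 0))
         (CSeq (CSetR ''xout'' (ivar ''i'') (ivar ''j'') (RCell ''x'' (ivar ''i'') (ivar ''j'')))
           (set_rvar ''m'' (RPlus (rvar ''m'') (RCell ''x'' (ivar ''i'') (ivar ''j''))))))
       (\<lambda>s'. imem s' ''i'' 0 0 = i \<and> imem s' ''n'' 0 0 = n \<and> C (Suc i) (set_icell ''i'' 0 0 (Suc i) s')) s"
    if "i < n" "C i s" "imem s ''i'' 0 0 = i" for i s
    using that R[of i] G_R[OF G_Y[of i]] j
    by (intro wp_CIf wp_CSeq wp_CSetR) (simp_all add: C_def R_01 less_Suc_eq big_def[of i j])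
  show ?thesis
    unfolding big_com_def
    apply (rule wp_CSeq, rule wp_CSetR, simp, simp, simp add: R_01)
    apply (rule wp_CFor[where m = n and I = C])
          apply (use n_bounds s out in \<open>simp_all add: C_def\<close>)[6]
    subgoal by (rule body)
    subgoal by (simp add: C_def)
    done
qed

text \<open>The big values account for \<open>n\<close> terms, every small value considered so far
  for at most one more.\<close>

lemma total_in_gsums: "j < n \<Longrightarrow> i \<le> n \<Longrightarrow> total j i \<in> gsums G (n + i)"
proof (induction i)
  case 0
  then show ?case using G_01 G_X by (auto intro!: gsums_sum)
next
  case (Suc i)
  then show ?case using gsums_add[of "total j i" G "n + i"] G_Y[of i] G_01
    by (simp del: gsums.simps)
qed

lemma small_correct:
  assumes j: "j < n" and s: "solved s" "imem s ''j'' 0 0 = j"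
    and out: "\<And>i j'. i < n \<Longrightarrow> j' < j \<Longrightarrow> rmem s ''xout'' i j' = rounded i j'"
    and big: "\<And>i. i < n \<Longrightarrow> rmem s ''xout'' i j = (if big i j then X i j else 0)"
    and m: "rmem s ''m'' 0 0 = total j 0"
  shows "wp small_com (\<lambda>s'. solved s' \<and> imem s' ''j'' 0 0 = j \<and>
    (\<forall>i<n. \<forall>j'<Suc j. rmem s' ''xout'' i j' = rounded i j')) s"
proof -
  define C where "C i s \<longleftrightarrow> solved s \<and> imem s ''j'' 0 0 = j \<and>
    (\<forall>i<n. \<forall>j'<j. rmem s ''xout'' i j' = rounded i j') \<and>
    (\<forall>i'<n. rmem s ''xout'' i' j =
       (if i' < i then rounded i' j else if big i' j then X i' j else 0)) \<and>
    rmem s ''m'' 0 0 = total j i" for i s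
  have R: "total j i + \<gamma> * Y i \<in> R" if "i < n" for i
    using that total_in_gsums[OF j, of i] G_Y[OF that]
    by (auto intro!: in_R[of _ "Suc (n + i)"] gsums_add simp del: gsums.simps)
  have body: "wp (CIf (BAnd small_expr (BAnd
               (BOr (ILess (ICell ''own'' edge_expr (IConst 0)) (IPlus edge_expr (IConst 1)))
                 (ILess (IPlus edge_expr (IConst 1)) (ICell ''own'' edge_expr (IConst 0))))
               (BNot (RLess (RConst 1) (RPlus (rvar ''m'') scaled_y)))))
         (CSeq (CSetR ''xout'' (ivar ''i'') (ivar ''j'') scaled_y)
           (set_rvar ''m'' (RPlus (rvar ''m'') scaled_y)))
         CSkip)
       (\<lambda>s'. imem s' ''i'' 0 0 = i \<and> imem s' ''n'' 0 0 = n \<and> C (Suc i) (set_icell ''i'' 0 0 (Suc i) s')) s"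
    if "i < n" "C i s" "imem s ''i'' 0 0 = i" for i s
  proof -
    have e: "n * n + (i * n + j) = enode i j" "Suc (enode i j) \<le> K" "enode i j \<le> K"
      using enode_less[OF that(1) j] K_ge by (auto simp: enode_def)
    have sel: "own (enode i j) < Suc (enode i j) \<or> Suc (enode i j) < own (enode i j) \<longleftrightarrow> selected i j"
      unfolding selected_def by linarith
    let ?take = "\<not> big i j \<and> selected i j \<and> \<not> 1 < total j i + \<gamma> * Y i"
    have t: "total j (Suc i) = (if ?take then total j i + \<gamma> * Y i else total j i)"
      "rounded i j = (if ?take then \<gamma> * Y i else if big i j then X i j else 0)"
      unfolding rounded_def by auto
    have test: "bval (BAnd small_expr (BAnd
               (BOr (ILess (ICell ''own'' edge_expr (IConst 0)) (IPlus edge_expr (IConst 1)))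
                 (ILess (IPlus edge_expr (IConst 1)) (ICell ''own'' edge_expr (IConst 0))))
               (BNot (RLess (RConst 1) (RPlus (rvar ''m'') scaled_y))))) s \<longleftrightarrow> ?take"
      using that j sel by (simp add: C_def edge_expr_def e big_def)
    have C: "solved s" "imem s ''j'' 0 0 = j" "rmem s ''m'' 0 0 = total j i"
      "\<forall>i<n. \<forall>j'<j. rmem s ''xout'' i j' = rounded i j'"
      "\<forall>i'<n. rmem s ''xout'' i' j =
         (if i' < i then rounded i' j else if big i' j then X i' j else 0)"
      using that by (simp_all add: C_def)
    show ?thesis
    proof (rule wp_CIf, goal_cases)
      case 1
      show ?case using that C j e R[of i] G_R[OF G_Y[of i]] by (simp add: edge_expr_def R_01 n_bounds)
    next
      case 2
      then have ?take using test by blast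
      then show ?case using that C j R[of i] G_R[OF G_Y[of i]] t
        by (intro wp_CSeq wp_CSetR) (simp_all add: C_def less_Suc_eq del: total.simps)
    next
      case 3
      then have "\<not> ?take" using test by blast
      then have "total j (Suc i) = total j i" "rounded i j = (if big i j then X i j else 0)"
        unfolding t by argo+
      then show ?case using that C
        by (intro wp_CSkip) (simp add: C_def less_Suc_eq del: total.simps)
    qed
  qed
  show ?thesis
    unfolding small_com_def
    apply (rule wp_CFor[where m = n and I = C])
          apply (use n_bounds s out big m in \<open>simp_all add: C_def\<close>)[6]
    subgoal by (rule body)
    subgoal by (simp add: C_def less_Suc_eq)
    done
qed

lemma output_correct:
  assumes "solved s"
  shows "wp output_com (\<lambda>s'. (\<forall>i<n. \<forall>j<n. output_x s' i j = rounded i j) \<and>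
    (\<forall>i<n. output_y s' i = Y i)) s"
  unfolding output_com_def
  apply (rule wp_CSeq)
  apply (rule wp_CFor[where m = n and
        I = "\<lambda>j s. solved s \<and> (\<forall>i<n. \<forall>j'<j. rmem s ''xout'' i j' = rounded i j')"])
        apply (use n_bounds assms in simp_all)[6]
  subgoal for j s
    apply (rule wp_CSeq, rule wp_mono[OF big_correct[of j]])
        apply simp_all[4]
    apply (rule wp_mono[OF small_correct[of j]])
          apply (simp_all del: total.simps)
    done
  subgoal for s
    apply (rule wp_CFor[where m = n and
          I = "\<lambda>i s. solved s \<and> (\<forall>i<n. \<forall>j<n. rmem s ''xout'' i j = rounded i j) \<and>
            (\<forall>i'<i. rmem s ''yout'' i' 0 = Y i')"])
          apply (use n_bounds in simp_all)[6]
    subgoal by (rule wp_CSetR) (simp_all add: less_Suc_eq n_bounds)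
    subgoal by (simp add: output_x_def output_y_def)
    done
  done

end

lemma (in rounding_run) rounding_com_correct:
  assumes "inputs s" "cleared s" "has_graph {} s" "free_nodes {} s"
  shows "wp rounding_com (\<lambda>s'. \<exists>x'. good_rounding x' \<and>
    (\<forall>i<n. \<forall>j<n. output_x s' i j = x' i j) \<and> (\<forall>i<n. output_y s' i = Y i)) s"
proof -
  let ?Q = "\<lambda>s'. \<exists>x'. good_rounding x' \<and>
    (\<forall>i<n. \<forall>j<n. output_x s' i j = x' i j) \<and> (\<forall>i<n. output_y s' i = Y i)"
  have out: "wp output_com ?Q s1" if at: "at_auction {} own lab s1" for own lab s1
  proof -
    have "matched_run wi wr B M K R n X D Y \<gamma> T G own lab"
      by (intro matched_run.intro matched_instance.intro matched_instance_axioms.intro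
          rounding_run_axioms rounding_instance_axioms at_auction_inv[OF at])
    then interpret matched_run wi wr B M K R n X D Y \<gamma> T G own lab .
    have "solved s1" using at unfolding at_auction_def solved_def by (elim conjE) (intro conjI)
    then show ?thesis
      by (rule wp_mono[OF output_correct]) (rule exI[of _ rounded], rule conjI[OF good_rounding_rounded])
  qed
  have auction: "wp (CSeq auction_com output_com) ?Q s1"
    if "inputs s1" "cleared s1" "has_graph graph s1" "free_nodes (Domain graph) s1" "coded s1" for s1
    by (rule wp_CSeq, rule wp_mono[OF auction_correct[OF that]], elim exE, rule out)
  have graph: "wp (CSeq graph_com (CSeq auction_com output_com)) ?Q s1"
    if "inputs s1" "cleared s1" "has_graph {} s1" "free_nodes {} s1" "coded s1" for s1
    by (rule wp_CSeq, rule wp_mono[OF graph_correct[OF that]], elim conjE, rule auction)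
  show ?thesis
    unfolding rounding_com_def CSeqs.simps
    by (rule wp_CSeq, rule wp_mono[OF weights_correct[OF assms]], elim conjE, rule graph)
qed

section \<open>Bit sizes of rational numbers\<close>

text \<open>Asks for some fraction, not necessarily in lowest terms, so closure under arithmetic
  needs no reasoning about common divisors.\<close>

definition has_bits :: "nat \<Rightarrow> real \<Rightarrow> bool" where
  "has_bits k r \<longleftrightarrow> (\<exists>a b :: int. r = of_int a / of_int b \<and> 0 < b \<and> \<bar>a\<bar> \<le> 2 ^ k \<and> b \<le> 2 ^ k)"

lemma has_bitsI: "r = of_int a / of_int b \<Longrightarrow> 0 < b \<Longrightarrow> \<bar>a\<bar> \<le> 2 ^ k \<Longrightarrow> b \<le> 2 ^ k \<Longrightarrow> has_bits k r"
  unfolding has_bits_def by blast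

lemma has_bits_mono:
  assumes "has_bits k r" "k \<le> l"
  shows "has_bits l r"
proof -
  have "(2 :: int) ^ k \<le> 2 ^ l" using assms(2) by (rule power_increasing) simp
  moreover obtain a b :: int where "r = of_int a / of_int b" "0 < b" "\<bar>a\<bar> \<le> 2 ^ k" "b \<le> 2 ^ k"
    using assms(1) unfolding has_bits_def by blast
  ultimately show ?thesis by (intro has_bitsI[of r a b]) linarith+
qed

lemma has_bits_0: "has_bits k 0" and has_bits_1: "has_bits k 1"
  by (rule has_bitsI[of _ 0 1] has_bitsI[of _ 1 1]; simp)+

lemma has_bits_mult:
  assumes "has_bits k r" "has_bits l q"
  shows "has_bits (k + l) (r * q)"
proof -
  from assms obtain a b c d :: int where 1: "r = of_int a / of_int b" "0 < b" "\<bar>a\<bar> \<le> 2 ^ k" "b \<le> 2 ^ k"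
    and 2: "q = of_int c / of_int d" "0 < d" "\<bar>c\<bar> \<le> 2 ^ l" "d \<le> 2 ^ l"
    unfolding has_bits_def by blast
  have "\<bar>a\<bar> * \<bar>c\<bar> \<le> 2 ^ k * 2 ^ l" "b * d \<le> 2 ^ k * 2 ^ l"
    using 1 2 by (auto intro!: mult_mono)
  then show ?thesis
    using 1 2 by (intro has_bitsI[of _ "a * c" "b * d"]) (auto simp: abs_mult power_add)
qed

lemma has_bits_divide:
  assumes "has_bits k r" "has_bits l q"
  shows "has_bits (k + l) (r / q)"
proof -
  from assms(2) obtain c d :: int where 2: "q = of_int c / of_int d" "0 < d" "\<bar>c\<bar> \<le> 2 ^ l" "d \<le> 2 ^ l"
    unfolding has_bits_def by blast
  show ?thesis
  proof (cases "c = 0")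
    case True
    then show ?thesis using 2 by (simp add: has_bits_0)
  next
    case False
    have "1 / q = of_int (sgn c * d) / of_int \<bar>c\<bar>"
      unfolding 2(1) using False by (auto simp: sgn_if)
    then have "has_bits l (1 / q)"
      using 2 False by (intro has_bitsI[of _ "sgn c * d" "\<bar>c\<bar>"]) (auto simp: abs_mult)
    from has_bits_mult[OF assms(1) this] show ?thesis by simp
  qed
qed

lemma has_bits_add:
  assumes "has_bits k r" "has_bits l q"
  shows "has_bits (Suc (k + l)) (r + q)"
proof -
  from assms obtain a b c d :: int where 1: "r = of_int a / of_int b" "0 < b" "\<bar>a\<bar> \<le> 2 ^ k" "b \<le> 2 ^ k"
    and 2: "q = of_int c / of_int d" "0 < d" "\<bar>c\<bar> \<le> 2 ^ l" "d \<le> 2 ^ l"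
    unfolding has_bits_def by blast
  have "\<bar>a\<bar> * d \<le> 2 ^ k * 2 ^ l" "\<bar>c\<bar> * b \<le> 2 ^ l * 2 ^ k" "b * d \<le> 2 ^ k * 2 ^ l"
    using 1 2 by (auto intro!: mult_mono)
  moreover have "\<bar>a * d + c * b\<bar> \<le> \<bar>a\<bar> * d + \<bar>c\<bar> * b"
    using 1 2 abs_triangle_ineq[of "a * d" "c * b"] by (simp add: abs_mult)
  moreover have "0 \<le> (2 :: int) ^ k * 2 ^ l" by simp
  ultimately have "\<bar>a * d + c * b\<bar> \<le> 2 ^ Suc (k + l)" "b * d \<le> 2 ^ Suc (k + l)"
    unfolding power_Suc power_add by (simp_all add: mult.commute)
  then show ?thesis
    using 1 2 by (intro has_bitsI[of _ "a * d + c * b" "b * d"]) (auto simp: field_simps)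
qed

text \<open>Adding fractions multiplies denominators, so each term contributes its \<open>k\<close>
  bits and one for the sum of the two cross products. The length is linear in the number of
  terms.\<close>

lemma has_bits_gsums:
  assumes "\<And>g. g \<in> G \<Longrightarrow> has_bits k g"
  shows "r \<in> gsums G m \<Longrightarrow> has_bits (m * Suc k) r"
proof (induction m arbitrary: r)
  case (Suc m)
  from Suc.prems consider "r \<in> gsums G m" | r' g where "r = r' + g" "r' \<in> gsums G m" "g \<in> G"
    by auto
  then show ?case
  proof cases
    case 1
    then show ?thesis using Suc.IH has_bits_mono by fastforce
  next
    case 2
    then show ?thesis using has_bits_add[OF Suc.IH assms, of r' g] by (simp add: add.commute add.left_commute)
  qed
qed (simp add: has_bits_0)

lemma bit_isize_le:
  assumes "m \<le> 2 ^ k"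
  shows "bit_isize m \<le> k + 2"
proof -
  have "m < 2 ^ Suc k" using assms by (rule order.strict_trans1) simp
  then have "floorlog 2 m \<le> Suc k" by (intro floorlog_leI) auto
  then show ?thesis by (simp add: bit_isize_def)
qed

lemma bit_isize_le_Suc: "bit_isize m \<le> Suc m"
proof -
  have "floorlog 2 m \<le> m" by (intro floorlog_leI) (auto simp: less_exp)
  then show ?thesis by (simp add: bit_isize_def)
qed

lemma less_pow_bit_isize: "m < 2 ^ bit_isize m"
proof (cases "m = 0")
  case False
  then have "m < 2 ^ floorlog 2 m" using floorlog_bounds[of m 2] by simp
  also have "\<dots> \<le> 2 ^ bit_isize m" by (simp add: bit_isize_def)
  finally show ?thesis .
qed simp

lemma bit_rsize_of_rat: "bit_rsize (of_rat q) = rat_size q"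
  unfolding bit_rsize_def by simp

text \<open>\<open>bit_rsize\<close> looks at the reduced fraction; dividing by the gcd shrinks
  numerator and denominator, and each then has size at most \<open>k + 2\<close>.\<close>

lemma bit_rsize_le:
  assumes "has_bits k r"
  shows "bit_rsize r \<le> 2 * k + 4"
proof -
  obtain a b :: int where 1: "r = of_int a / of_int b" "0 < b" "\<bar>a\<bar> \<le> 2 ^ k" "b \<le> 2 ^ k"
    using assms unfolding has_bits_def by blast
  have r: "r = of_rat (Fract a b)" using 1 by (simp add: of_rat_rat)
  let ?g = "gcd a b"
  have q: "quotient_of (Fract a b) = (a div ?g, b div ?g)"
    using 1 by (simp add: quotient_of_Fract Rat.normalize_def Let_def)
  have g: "?g > 0" using 1 by simp
  have le: "\<bar>c div ?g\<bar> \<le> \<bar>c\<bar>" if dvd: "?g dvd c" for c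
  proof -
    obtain e where e: "c = ?g * e" using dvd by (elim dvdE)
    have "1 * \<bar>e\<bar> \<le> ?g * \<bar>e\<bar>" by (rule mult_right_mono) (use g in linarith, simp)
    moreover have "c div ?g = e" "\<bar>c\<bar> = ?g * \<bar>e\<bar>"
      using e g by (metis nonzero_mult_div_cancel_left less_irrefl) (metis e g abs_mult abs_of_pos)
    ultimately show ?thesis by simp
  qed
  have "\<bar>a div ?g\<bar> \<le> \<bar>a\<bar>" "b div ?g \<le> b" using le[of a] le[of b] 1 by auto
  then have "nat \<bar>a div ?g\<bar> \<le> 2 ^ k" "nat (b div ?g) \<le> 2 ^ k"
    using 1 by (auto simp: nat_le_iff)
  then have "bit_isize (nat \<bar>a div ?g\<bar>) + bit_isize (nat (b div ?g)) \<le> (k + 2) + (k + 2)"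
    by (intro add_mono bit_isize_le)
  then show ?thesis unfolding r bit_rsize_of_rat by (simp add: rat_size_def q)
qed

lemma has_bits_bit_rsize:
  assumes "r \<in> \<rat>"
  shows "has_bits (bit_rsize r) r"
proof -
  obtain q where r: "r = of_rat q" using assms by (elim Rats_cases)
  obtain a b where q: "quotient_of q = (a, b)" by (cases "quotient_of q")
  have b: "0 < b" using q by (rule quotient_of_denom_pos)
  have size: "bit_rsize r = bit_isize (nat \<bar>a\<bar>) + bit_isize (nat b)"
    by (simp add: r bit_rsize_of_rat rat_size_def q)
  have "nat \<bar>a\<bar> \<le> 2 ^ bit_rsize r" "nat b \<le> 2 ^ bit_rsize r"
    using less_pow_bit_isize[of "nat \<bar>a\<bar>"] less_pow_bit_isize[of "nat b"]
    unfolding size by (meson le_add1 le_add2 less_imp_le_nat one_le_numeral order_trans power_increasing)+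
  then have "\<bar>a\<bar> \<le> 2 ^ bit_rsize r" "b \<le> 2 ^ bit_rsize r"
    using b by (simp_all add: nat_le_iff)
  moreover have "r = of_int a / of_int b"
    using quotient_of_div[OF q] r by (simp add: of_rat_divide)
  ultimately show ?thesis using b by (intro has_bitsI)
qed

section \<open>The theorem\<close>

locale sc_lp_input =
  fixes n :: nat and F C :: "nat set" and d :: "nat \<Rightarrow> nat \<Rightarrow> real" and T \<mu> \<gamma> :: real
    and x :: "nat \<Rightarrow> nat \<Rightarrow> real" and y :: "nat \<Rightarrow> real"
  assumes FC: "F \<union> C = {..<n}" and metric: "Metric_space (F \<union> C) d" and T_pos': "T > 0"
    and gamma': "0 < \<gamma>" "\<gamma> < 1" and lp: "relaxed_SC_LP F C d T \<mu> x y"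
begin

text \<open>These zero extensions agree with the contents of the input arrays in
  \<open>input_state\<close>, so program and rounding instance share their data.\<close>

definition X :: "nat \<Rightarrow> nat \<Rightarrow> real" where
  "X i j = (if i \<in> F \<and> j \<in> C then x i j else 0)"

definition Y :: "nat \<Rightarrow> real" where
  "Y i = (if i \<in> F then y i else 0)"

definition D :: "nat \<Rightarrow> nat \<Rightarrow> real" where
  "D i j = (if i < n \<and> j < n then d i j else 0)"

abbreviation "start \<equiv> input_state n F C d T \<gamma> x y"

lemma lpD:
  assumes "i \<in> F"
  shows "load C d x i \<le> \<mu> * T * y i" "0 \<le> y i" "y i \<le> 1"
    "j \<in> C \<Longrightarrow> x i j \<le> y i" "j \<in> C \<Longrightarrow> 0 \<le> x i j" "j \<in> C \<Longrightarrow> T < d i j \<Longrightarrow> x i j = 0"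
  using assms lp unfolding relaxed_SC_LP_def by auto

lemma in_range: "i \<in> F \<Longrightarrow> i < n" "j \<in> C \<Longrightarrow> j < n"
  using FC by auto

lemma finite_FC: "finite F" "finite C"
  using in_range by (auto intro: finite_subset[of _ "{..<n}"])

lemma sum_F: "(\<And>i. i < n \<Longrightarrow> i \<notin> F \<Longrightarrow> h i = 0) \<Longrightarrow> (\<Sum>i\<in>F. h i) = (\<Sum>i<n. h i)"
  and sum_C: "(\<And>j. j < n \<Longrightarrow> j \<notin> C \<Longrightarrow> h j = 0) \<Longrightarrow> (\<Sum>j\<in>C. h j) = (\<Sum>j<n. h j)"
  for h :: "nat \<Rightarrow> real"
  using in_range by (auto intro!: sum.mono_neutral_left)

lemma sum_X: "j \<in> C \<Longrightarrow> (\<Sum>i<n. X i j) = 1"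
proof -
  assume j: "j \<in> C"
  have "(\<Sum>i<n. X i j) = (\<Sum>i\<in>F. X i j)" by (rule sum_F[symmetric]) (simp add: X_def)
  also have "\<dots> = (\<Sum>i\<in>F. x i j)" using j by (simp add: X_def)
  also have "\<dots> = 1" using lp j unfolding relaxed_SC_LP_def by blast
  finally show ?thesis .
qed

sublocale rounding_instance n X D Y \<gamma> T
proof
  show "D i j \<le> T" if "X i j \<noteq> 0" for i j
  proof -
    have "i \<in> F" "j \<in> C" "x i j \<noteq> 0" using that unfolding X_def by (auto split: if_splits)
    then show ?thesis using lpD(6)[of i j] in_range by (auto simp: D_def not_less[symmetric])
  qed
  show "0 \<le> D i j" for i j
    using Metric_space.nonneg[OF metric] by (simp add: D_def)
  show "(\<Sum>i<n. X i j) \<le> 1" for j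
    using sum_X[of j] by (cases "j \<in> C") (simp_all add: X_def)
qed (use gamma' T_pos' lpD in \<open>auto simp: X_def Y_def\<close>)

lemma rounded_solution_if_good:
  assumes good: "good_rounding x'" and out: "\<And>i j. i < n \<Longrightarrow> j < n \<Longrightarrow> ox i j = x' i j"
    "\<And>i. i < n \<Longrightarrow> oy i = Y i"
  shows "rounded_solution F C d T \<mu> \<gamma> x y ox oy"
proof -
  have pt: "0 \<le> x' i j" "X i j = 0 \<Longrightarrow> x' i j = 0" "x' i j \<le> Y i" "0 < x' i j \<Longrightarrow> \<gamma> * Y i \<le> x' i j"
    if "i < n" "j < n" for i j
    using good that unfolding good_rounding_def by blast+
  have clients: "(\<Sum>i<n. x' i j) \<le> 1" "(\<Sum>i<n. X i j) - \<gamma> \<le> (\<Sum>i<n. x' i j)" if "j < n" for j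
    using good that unfolding good_rounding_def by blast+
  have loads: "(\<Sum>j<n. D i j * x' i j) \<le> (\<Sum>j<n. D i j * X i j) + \<gamma> * T * Y i" if "i < n" for i
    using good that unfolding good_rounding_def by blast
  have XY: "X i j = x i j" "Y i = y i" if "i \<in> F" "j \<in> C" for i j
    using that by (simp_all add: X_def Y_def)
  have Y: "Y i = y i" if "i \<in> F" for i using that by (simp add: Y_def)
  have sums: "(\<Sum>i\<in>F. ox i j) = (\<Sum>i<n. x' i j)" if "j \<in> C" for j
  proof -
    have "(\<Sum>i\<in>F. ox i j) = (\<Sum>i\<in>F. x' i j)" using out in_range that by (intro sum.cong) auto
    also have "\<dots> = (\<Sum>i<n. x' i j)"
      using in_range that by (intro sum_F pt(2)) (auto simp: X_def)
    finally show ?thesis .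
  qed
  have load': "load C d ox i \<le> (\<mu> + 2 - \<gamma>) * T * y i" if i: "i \<in> F" for i
  proof -
    have "load C d ox i = (\<Sum>j\<in>C. D i j * x' i j)"
      unfolding load_def using out in_range i by (intro sum.cong) (auto simp: D_def)
    also have "\<dots> = (\<Sum>j<n. D i j * x' i j)"
      using in_range i by (intro sum_C) (simp add: pt(2) X_def)
    also have "\<dots> \<le> (\<Sum>j<n. D i j * X i j) + \<gamma> * T * y i"
      using loads[OF in_range(1)[OF i]] Y[OF i] by simp
    also have "(\<Sum>j<n. D i j * X i j) = (\<Sum>j\<in>C. D i j * X i j)"
      by (rule sum_C[symmetric]) (simp add: X_def)
    also have "\<dots> = load C d x i"
      unfolding load_def using in_range i by (intro sum.cong) (auto simp: D_def X_def)
    also have "load C d x i + \<gamma> * T * y i \<le> \<mu> * T * y i + (2 - \<gamma>) * T * y i"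
    proof (rule add_mono)
      \<comment> \<open>The rounding achieves the factor \<open>\<mu> + \<gamma>\<close>; since
        \<open>\<gamma> < 1\<close>, also \<open>\<gamma> \<le> 2 - \<gamma>\<close>, and the
        required bound follows.\<close>
      show "\<gamma> * T * y i \<le> (2 - \<gamma>) * T * y i"
        using gamma' T_pos' lpD(2)[OF i] by (intro mult_right_mono) auto
    qed (rule lpD(1)[OF i])
    finally show ?thesis by (simp add: algebra_simps)
  qed
  have "x' i j \<le> y i" "0 < x' i j \<longrightarrow> \<gamma> * y i \<le> x' i j" if "i \<in> F" "j \<in> C" for i j
    using pt(3,4)[of i j] in_range that Y by auto
  moreover have "1 - \<gamma> \<le> (\<Sum>i<n. x' i j)" if "j \<in> C" for j
    using clients(2)[of j] sum_X[OF that] in_range that by simp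
  ultimately show ?thesis
    unfolding rounded_solution_def
    using pt(1,2) out XY(1) Y clients(1) sums load' by (simp add: in_range)
qed

lemma run_correct:
  assumes "cost_model wi wr B K R"
    and "Suc (n * n + n * n) \<le> K" "Suc (n * n + n * n) \<le> M"
    and "0 \<in> G" "1 \<in> G"
    and "\<And>i j. i < n \<Longrightarrow> j < n \<Longrightarrow> X i j \<in> G" and "\<And>i. i < n \<Longrightarrow> \<gamma> * Y i \<in> G"
    and "\<And>i j. i < n \<Longrightarrow> j < n \<Longrightarrow> w i j \<in> G"
    and "gsums G (2 * n + 2) \<subseteq> R"
    and mem: "\<And>a i j. rmem start a i j \<in> R"
  shows "\<exists>t s. exec wi wr rounding_com start t s \<and> t \<le> ctime B M rounding_com \<and>
    rounded_solution F C d T \<mu> \<gamma> x y (output_x s) (output_y s)"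
proof -
  interpret cost_model wi wr B M K R by fact
  have "rounding_run wi wr B M K R n X D Y \<gamma> T G"
    by (intro rounding_run.intro rounding_run_axioms.intro rounding_instance_axioms assms)
  then interpret rounding_run wi wr B M K R n X D Y \<gamma> T G .
  have "1 \<le> K" "n \<le> K" using n_bounds by auto
  then have "bounded_state start"
    using mem by (auto simp: bounded_state_def input_state_def)
  moreover have "wp rounding_com (\<lambda>s'. \<exists>x'. good_rounding x' \<and>
      (\<forall>i<n. \<forall>j<n. output_x s' i j = x' i j) \<and> (\<forall>i<n. output_y s' i = Y i)) start"
    by (rule rounding_com_correct)
      (auto simp: inputs_def cleared_def has_graph_def free_nodes_def input_state_def
        X_def Y_def D_def fun_eq_iff)
  ultimately obtain t s x' where run: "exec wi wr rounding_com start t s" "t \<le> ctime B M rounding_com"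
    and out: "good_rounding x'" "\<forall>i<n. \<forall>j<n. output_x s i j = x' i j" "\<forall>i<n. output_y s i = Y i"
    unfolding wp_def by blast
  have "rounded_solution F C d T \<mu> \<gamma> x y (output_x s) (output_y s)"
    using out(2,3) by (intro rounded_solution_if_good[OF out(1)]) simp_all
  with run show ?thesis by blast
qed

end

text \<open>The sum of two bounds for input size \<open>z\<close>: \<open>2 * z * z + 2\<close> for
  the naturals up to \<open>loop_poly\<close>, whose length is at most their value plus one, and
  \<open>2 * k + 4\<close> with \<open>k = (2 * z + 2) * (3 * z + 1)\<close> for the
  numbers.\<close>

definition value_poly :: "nat poly" where
  "value_poly = [:10, 16, 14:]"

text \<open>For \<open>n \<le> z\<close> this dominates the number of nodes plus one, and is used
  both as the loop bound \<open>M\<close> and as the bound \<open>K\<close> on naturals.\<close>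

definition loop_poly :: "nat poly" where
  "loop_poly = [:1, 0, 2:]"

lemma poly_value_poly: "poly value_poly z = 10 + 16 * z + 14 * (z * z)"
  and poly_loop_poly: "poly loop_poly z = 1 + 2 * (z * z)"
  by (simp_all add: value_poly_def loop_poly_def algebra_simps)

lemma n_le_input_size:
  assumes "\<And>k. 1 \<le> wi k"
  shows "n \<le> input_size wi wr n F C d T \<gamma> x y"
proof -
  have "n = (\<Sum>i<n. 1)" by simp
  also have "\<dots> \<le> (\<Sum>i<n. wi (of_bool (i \<in> F)) + wi (of_bool (i \<in> C)))"
    using assms by (intro sum_mono) (simp add: trans_le_add1)
  finally show ?thesis unfolding input_size_def by simp
qed

context sc_lp_input
begin

lemma nodes_le_loop_poly: "n \<le> z \<Longrightarrow> Suc (n * n + n * n) \<le> poly loop_poly z"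
  using mult_le_mono[of n z n z] unfolding poly_loop_poly by simp

lemma unit_cost_run:
  "\<exists>t s. exec unit_isize unit_rsize rounding_com start t s \<and>
    t \<le> poly (ctime_poly value_poly loop_poly rounding_com)
          (input_size unit_isize unit_rsize n F C d T \<gamma> x y) \<and>
    rounded_solution F C d T \<mu> \<gamma> x y (output_x s) (output_y s)"
proof -
  let ?z = "input_size unit_isize unit_rsize n F C d T \<gamma> x y"
  have "n \<le> ?z" by (rule n_le_input_size) (simp add: unit_isize_def)
  then have K: "Suc (n * n + n * n) \<le> poly loop_poly ?z" by (rule nodes_le_loop_poly)
  have "cost_model unit_isize unit_rsize (poly value_poly ?z) (poly loop_poly ?z) UNIV"
    by unfold_locales (auto simp: unit_isize_def unit_rsize_def poly_value_poly)
  from run_correct[OF this K K, of UNIV] show ?thesis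
    unfolding poly_ctime_poly by simp
qed

lemma bit_cost_run:
  assumes "rational_input n F C d T \<gamma> x y"
  shows "\<exists>t s. exec bit_isize bit_rsize rounding_com start t s \<and>
    t \<le> poly (ctime_poly value_poly loop_poly rounding_com)
          (input_size bit_isize bit_rsize n F C d T \<gamma> x y)"
proof -
  define z where "z = input_size bit_isize bit_rsize n F C d T \<gamma> x y"
  \<comment> \<open>At most \<open>2 * z + 2\<close> summands of \<open>3 * z\<close> bits, with one
    extra bit for each addition; \<open>3 * z\<close> comes from the quotient of
    \<open>X i j\<close> by the product \<open>\<gamma> * Y i\<close>.\<close>
  define k where "k = (2 * z + 2) * Suc (3 * z)"
  have n: "n \<le> z" unfolding z_def by (rule n_le_input_size) (simp add: bit_isize_def)
  then have K: "Suc (n * n + n * n) \<le> poly loop_poly z" by (rule nodes_le_loop_poly)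
  have bits: "has_bits z r" if "r \<in> \<rat>" "bit_rsize r \<le> z" for r
    using has_bits_mono[OF has_bits_bit_rsize] that by blast
  have sizes: "bit_rsize T \<le> z" "bit_rsize \<gamma> \<le> z"
    unfolding z_def input_size_def by simp_all
  have size_d: "bit_rsize (d i j) \<le> z" if "i < n" "j < n" for i j
  proof -
    have "bit_rsize (d i j) \<le> (\<Sum>j<n. bit_rsize (d i j))"
      using that by (intro member_le_sum) auto
    also have "\<dots> \<le> (\<Sum>i<n. \<Sum>j<n. bit_rsize (d i j))"
      using that by (intro member_le_sum[of i]) auto
    finally show ?thesis unfolding z_def input_size_def by simp
  qed
  have size_x: "bit_rsize (x i j) \<le> z" if "i \<in> F" "j \<in> C" for i j
  proof -
    have "bit_rsize (x i j) \<le> (\<Sum>j\<in>C. bit_rsize (x i j))"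
      using that finite_FC by (intro member_le_sum) auto
    also have "\<dots> \<le> (\<Sum>i\<in>F. \<Sum>j\<in>C. bit_rsize (x i j))"
      using that finite_FC by (intro member_le_sum[of i]) auto
    finally show ?thesis unfolding z_def input_size_def by simp
  qed
  have size_y: "bit_rsize (y i) \<le> z" if "i \<in> F" for i
  proof -
    have "bit_rsize (y i) \<le> (\<Sum>i\<in>F. bit_rsize (y i))"
      using that finite_FC by (intro member_le_sum) auto
    then show ?thesis unfolding z_def input_size_def by simp
  qed
  have rat: "T \<in> \<rat>" "\<gamma> \<in> \<rat>" "i < n \<Longrightarrow> j < n \<Longrightarrow> d i j \<in> \<rat>" "i \<in> F \<Longrightarrow> j \<in> C \<Longrightarrow> x i j \<in> \<rat>"
    "i \<in> F \<Longrightarrow> y i \<in> \<rat>" for i j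
    using assms unfolding rational_input_def by blast+
  have bits_X: "has_bits z (X i j)" and bits_Y: "has_bits z (Y i)" for i j
    by (simp_all add: X_def Y_def has_bits_0 bits rat size_x size_y)
  have bits_gY: "has_bits (z + z) (\<gamma> * Y i)" for i
    using bits[OF rat(2) sizes(2)] bits_Y by (rule has_bits_mult)
  have "has_bits (z + (z + z)) (w i j)" for i j
    using has_bits_divide[OF bits_X bits_gY] by (simp add: w_def has_bits_0)
  then have bits_w: "has_bits (3 * z) (w i j)" for i j by (simp add: numeral_3_eq_3)
  have zk: "z \<le> k" unfolding k_def by simp
  have model: "cost_model bit_isize bit_rsize (poly value_poly z) (poly loop_poly z)
      {r. has_bits k r}"
  proof
    show "bit_isize m \<le> poly value_poly z" if "m \<le> poly loop_poly z" for m
      using bit_isize_le_Suc[of m] that unfolding poly_value_poly poly_loop_poly by simp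
    show "bit_rsize r \<le> poly value_poly z" if "r \<in> {r. has_bits k r}" for r
      using bit_rsize_le[of k r] that unfolding poly_value_poly k_def by (simp add: algebra_simps)
  qed (auto simp: poly_value_poly has_bits_0 has_bits_1)
  have sums: "gsums {r. has_bits (3 * z) r} (2 * n + 2) \<subseteq> {r. has_bits k r}"
  proof
    fix r assume "r \<in> gsums {r. has_bits (3 * z) r} (2 * n + 2)"
    then have "has_bits ((2 * n + 2) * Suc (3 * z)) r" by (rule has_bits_gsums[rotated]) simp
    moreover have "(2 * n + 2) * Suc (3 * z) \<le> k" unfolding k_def using n by (intro mult_le_mono1) simp
    ultimately show "r \<in> {r. has_bits k r}" using has_bits_mono by blast
  qed
  have mem: "rmem start a i j \<in> {r. has_bits k r}" for a i j
    unfolding input_state_def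
    using has_bits_mono[OF bits zk] rat sizes size_d size_x size_y by (auto simp: has_bits_0)
  show ?thesis
    using run_correct[OF model K K _ _ _ _ _ sums mem]
      has_bits_mono[OF bits_X, of "3 * z"] has_bits_mono[OF bits_gY, of "3 * z"] bits_w
    unfolding poly_ctime_poly z_def[symmetric] by (auto simp: has_bits_0 has_bits_1)
qed

end

theorem theorem5:
  shows "\<exists>(P :: com) (p :: nat poly).
    \<forall>(n :: nat) (F :: nat set) (C :: nat set) (d :: nat \<Rightarrow> nat \<Rightarrow> real)
      (T :: real) (\<mu> :: real) (\<gamma> :: real) (x :: nat \<Rightarrow> nat \<Rightarrow> real) (y :: nat \<Rightarrow> real).
      F \<union> C = {..<n} \<longrightarrow> Metric_space (F \<union> C) d \<longrightarrow> T > 0 \<longrightarrow> \<mu> \<ge> 1 \<longrightarrow> 0 < \<gamma> \<longrightarrow> \<gamma> < 1 \<longrightarrow>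
      relaxed_SC_LP F C d T \<mu> x y \<longrightarrow>
      (\<exists>s. (\<exists>t. exec unit_isize unit_rsize P (input_state n F C d T \<gamma> x y) t s \<and>
                 t \<le> poly p (input_size unit_isize unit_rsize n F C d T \<gamma> x y)) \<and>
           (rational_input n F C d T \<gamma> x y \<longrightarrow>
              (\<exists>t. exec bit_isize bit_rsize P (input_state n F C d T \<gamma> x y) t s \<and>
                   t \<le> poly p (input_size bit_isize bit_rsize n F C d T \<gamma> x y))) \<and>
           rounded_solution F C d T \<mu> \<gamma> x y (output_x s) (output_y s))"
proof (intro exI[of _ rounding_com] exI[of _ "ctime_poly value_poly loop_poly rounding_com"]
    allI impI)
  fix n :: nat and F C :: "nat set" and d :: "nat \<Rightarrow> nat \<Rightarrow> real" and T \<mu> \<gamma> :: real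
    and x :: "nat \<Rightarrow> nat \<Rightarrow> real" and y :: "nat \<Rightarrow> real"
  assume "F \<union> C = {..<n}" "Metric_space (F \<union> C) d" "T > 0" "\<mu> \<ge> 1" "0 < \<gamma>" "\<gamma> < 1"
    "relaxed_SC_LP F C d T \<mu> x y"
  then have "sc_lp_input n F C d T \<mu> \<gamma> x y" by (intro sc_lp_input.intro)
  then interpret sc_lp_input n F C d T \<mu> \<gamma> x y .
  from unit_cost_run obtain t s where 1: "exec unit_isize unit_rsize rounding_com start t s"
    "t \<le> poly (ctime_poly value_poly loop_poly rounding_com) (input_size unit_isize unit_rsize n F C d T \<gamma> x y)"
    "rounded_solution F C d T \<mu> \<gamma> x y (output_x s) (output_y s)" by blast
  \<comment> \<open>The bit-cost run ends in some state of its own; determinism identifies it with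
    the state \<open>s\<close> already known to be a solution.\<close>
  moreover have "\<exists>t. exec bit_isize bit_rsize rounding_com start t s \<and>
      t \<le> poly (ctime_poly value_poly loop_poly rounding_com) (input_size bit_isize bit_rsize n F C d T \<gamma> x y)"
    if "rational_input n F C d T \<gamma> x y"
    using bit_cost_run[OF that] exec_deterministic[OF 1(1)] by blast
  ultimately show "\<exists>s. (\<exists>t. exec unit_isize unit_rsize rounding_com start t s \<and>
       t \<le> poly (ctime_poly value_poly loop_poly rounding_com) (input_size unit_isize unit_rsize n F C d T \<gamma> x y)) \<and>
     (rational_input n F C d T \<gamma> x y \<longrightarrow> (\<exists>t. exec bit_isize bit_rsize rounding_com start t s \<and>
       t \<le> poly (ctime_poly value_poly loop_poly rounding_com) (input_size bit_isize bit_rsize n F C d T \<gamma> x y))) \<and>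
     rounded_solution F C d T \<mu> \<gamma> x y (output_x s) (output_y s)"
    by blast
qed

end
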